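(* Let $\eta,\beta\colon W\to A$ be maps with a homotopy pushout square whose two structure maps $A\to\Sigma_A W$ are both the same map $\theta\colon A\to\Sigma_A W$ (so $\theta\circ\eta\simeq\theta\circ\beta$). For every map $f\colon \Sigma_A W\to X$, setting $\iota_X=f\circ\theta\colon A\to X$, we have $$\mathrm{secat}(f)\le \mathrm{relcat}(\iota_X)\le \mathrm{hcat}(f)\le \mathrm{relcat}_1(\iota_X)\le \mathrm{relcat}(\iota_X)+1 .$$
   Context: Conventions. We work with pointed topological spaces and pointed maps; all constructions are up to homotopy and $\simeq$ denotes (pointed) homotopy. Homotopy commutative diagrams are understood in Mather's sense: each square comes with a chosen homotopy, and in a cube these homotopies are compatible. A "whisker map" $(a,b)$ is the map into a homotopy pullback (or out of a homotopy pushout) induced by its universal property from maps $a,b$ together with the relevant homotopy. A homotopy section of $g\colon G\to X$ is a map $\sigma\colon X\to G$ with $g\circ\sigma\simeq \mathrm{id}_X$. Ganea construction. For any map $\iota_X\colon A\to X$, put $G_0=A$, $g_0=\iota_X$, $\alpha_0=\mathrm{id}_A$. Inductively for $i\ge 0$, given $g_i\colon G_i\to X$, let $F_i$ be the homotopy pullback of $\iota_X\colon A\to X$ and $g_i\colon G_i\to X$, with projections $\eta_i\colon F_i\to A$ and $\beta_i\colon F_i\to G_i$; let $G_{i+1}$ be the homotopy pushout of $\eta_i$ and $\beta_i$, with structure maps $\alpha_{i+1}\colon A\to G_{i+1}$ and $\gamma_i\colon G_i\to G_{i+1}$; and let $g_{i+1}=(g_i,\iota_X)\colon G_{i+1}\to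 X$ be the induced whisker map, so $g_{i+1}\circ\gamma_i\simeq g_i$ and $g_{i+1}\circ\alpha_{i+1}\simeq\iota_X$. One has $\gamma_i\circ\alpha_i\simeq\alpha_{i+1}$. For $i<j$ put $\gamma_{i,j}=\gamma_{j-1}\circ\dots\circ\gamma_i\colon G_i\to G_j$, and $\gamma_{i,i}=\mathrm{id}$. One writes $G_i(\iota_X)$ to show the dependence on $\iota_X$. Invariants of a map $\iota_X$ (each is a least integer, $\infty$ if there is none): $\mathrm{secat}(\iota_X)$ is the least $n\ge0$ such that $g_n\colon G_n(\iota_X)\to X$ has a homotopy section; $\mathrm{relcat}(\iota_X)$ is the least $n\ge 0$ such that $g_n$ has a homotopy section $\sigma$ with $\sigma\circ\iota_X\simeq\alpha_n$; $\mathrm{relcat}_k(\iota_X)$ is the least $n\ge k$ such that $g_n$ has a homotopy section $\sigma$ with $\sigma\circ g_k\simeq\gamma_{k,n}$. The quantity $\mathrm{secat}(f)$ is defined by applying the Ganea construction to the map $f\colon\Sigma_AW\to X$. The map $\omega_n$ and the Hopf category. Let $\eta,\beta,\theta,f$ be as in the claim, $\iota_X=f\circ\theta$, $n\ge1$. The maps $\eta\colon W\to A$ and $\alpha_{n-1}\circ\beta\colon W\to G_{n-1}(\iota_X)$, with the homotopy $\iota_X\circ\eta= f\circ\theta\circ\eta\simeq f\circ\theta\circ\beta\simeq g_{n-1}\circ\alpha_{n-1}\circ\beta$ coming from the pushout square of $\Sigma_AW$, induce a whisker map $W\to F_{n-1}(\iota_X)$. Composing with the pushout square defining $G_n(\iota_X)$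 gives a homotopy $\alpha_n\circ\eta\simeq\gamma_{n-1}\circ\alpha_{n-1}\circ\beta$, and the homotopy pushout $\Sigma_AW$ then induces $\omega_n\colon\Sigma_AW\to G_n(\iota_X)$, restricting to $\alpha_n$ on the copy of $A$ that is the target of $\eta$ and to $\gamma_{n-1}\circ\alpha_{n-1}$ on the copy that is the target of $\beta$. One has $g_n\circ\omega_n\simeq f$ and $\omega_n\circ\theta\simeq\alpha_n$. The Hopf category $\mathrm{hcat}(f)$ (which depends on the data $\eta,\beta,f$) is the least integer $n\ge1$ such that $g_n\colon G_n(\iota_X)\to X$ has a homotopy section $\sigma$ with $\sigma\circ f\simeq\omega_n$. *)

theory Defs
  imports "HOL-Analysis.Analysis"
begin

text \<open>
  Homotopy theory of pointed topological spaces.  All homotopies preserve the base point and are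
  written with the time parameter in \<open>{0..1}\<close> as first argument, as in \<^const>\<open>homotopic_with\<close>.
  The standard homotopy pullback and the standard (reduced) homotopy pushout are taken as models.
\<close>

subsection \<open>Pointed spaces, maps and homotopies\<close>

datatype 'a pspace = PSpace (ptop: "'a topology") (pbase: 'a)

definition pointed_space :: "'a pspace \<Rightarrow> bool" where
  "pointed_space P \<longleftrightarrow> pbase P \<in> topspace (ptop P)"

abbreviation pts :: "'a pspace \<Rightarrow> 'a set" where
  "pts P \<equiv> topspace (ptop P)"

definition pmap :: "'a pspace \<Rightarrow> 'b pspace \<Rightarrow> ('a \<Rightarrow> 'b) \<Rightarrow> bool" where
  "pmap P Q f \<longleftrightarrow> continuous_map (ptop P) (ptop Q) f \<and> f (pbase P) = pbase Q"

definition phomotopic :: "'a pspace \<Rightarrow> 'b pspace \<Rightarrow> ('a \<Rightarrow> 'b) \<Rightarrow> ('a \<Rightarrow> 'b) \<Rightarrow> bool" where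
  "phomotopic P Q f g \<longleftrightarrow> homotopic_with (\<lambda>h. h (pbase P) = pbase Q) (ptop P) (ptop Q) f g"

text \<open>A chosen homotopy, as carried by a homotopy commutative square.\<close>

definition phomotopy ::
  "'a pspace \<Rightarrow> 'b pspace \<Rightarrow> ('a \<Rightarrow> 'b) \<Rightarrow> ('a \<Rightarrow> 'b) \<Rightarrow> (real \<times> 'a \<Rightarrow> 'b) \<Rightarrow> bool" where
  "phomotopy P Q f g h \<longleftrightarrow>
     continuous_map (prod_topology (top_of_set {0..1}) (ptop P)) (ptop Q) h \<and>
     (\<forall>x\<in>pts P. h (0, x) = f x) \<and> (\<forall>x\<in>pts P. h (1, x) = g x) \<and>
     (\<forall>t\<in>{0..1}. h (t, pbase P) = pbase Q)"

definition phomotopy_equivalence :: "'a pspace \<Rightarrow> 'b pspace \<Rightarrow> ('a \<Rightarrow> 'b) \<Rightarrow> bool" where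
  "phomotopy_equivalence P Q f \<longleftrightarrow> pmap P Q f \<and>
     (\<exists>g. pmap Q P g \<and> phomotopic P P (g \<circ> f) id \<and> phomotopic Q Q (f \<circ> g) id)"

definition homotopy_section ::
  "'g pspace \<Rightarrow> 'x pspace \<Rightarrow> ('g \<Rightarrow> 'x) \<Rightarrow> ('x \<Rightarrow> 'g) \<Rightarrow> bool" where
  "homotopy_section G X g \<sigma> \<longleftrightarrow> pmap X G \<sigma> \<and> phomotopic X X (g \<circ> \<sigma>) id"


subsection \<open>Homotopy pullbacks\<close>

text \<open>
  Paths are normalised to be \<^const>\<open>undefined\<close> outside the unit interval, so that a path is
  determined by its values on \<open>{0..1}\<close>.  They carry the compact-open topology.
\<close>

definition path_set :: "'x topology \<Rightarrow> (real \<Rightarrow> 'x) set" where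
  "path_set X = {p. pathin X p \<and> p \<in> extensional {0..1}}"

definition path_topology :: "'x topology \<Rightarrow> (real \<Rightarrow> 'x) topology" where
  "path_topology X = topology_generated_by
     {{p \<in> path_set X. p ` K \<subseteq> U} | K U. compact K \<and> K \<subseteq> {0..1} \<and> openin X U}"

text \<open>The space of triples \<open>(a, p, b)\<close> where \<open>p\<close> is a path from \<open>u a\<close> to \<open>v b\<close>.\<close>

definition hpb ::
  "'a pspace \<Rightarrow> 'b pspace \<Rightarrow> 'x pspace \<Rightarrow> ('a \<Rightarrow> 'x) \<Rightarrow> ('b \<Rightarrow> 'x) \<Rightarrow>
     ('a \<times> (real \<Rightarrow> 'x) \<times> 'b) pspace" where
  "hpb A B X u v = PSpace
     (subtopology (prod_topology (ptop A) (prod_topology (path_topology (ptop X)) (ptop B)))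
        {(a, p, b). p 0 = u a \<and> p 1 = v b})
     (pbase A, (\<lambda>t\<in>{0..1}. pbase X), pbase B)"

abbreviation hpb_fst :: "'a \<times> (real \<Rightarrow> 'x) \<times> 'b \<Rightarrow> 'a" where
  "hpb_fst \<equiv> fst"

abbreviation hpb_snd :: "'a \<times> (real \<Rightarrow> 'x) \<times> 'b \<Rightarrow> 'b" where
  "hpb_snd \<equiv> \<lambda>z. snd (snd z)"

text \<open>The homotopy from \<open>u \<circ> hpb_fst\<close> to \<open>v \<circ> hpb_snd\<close> that comes with the homotopy pullback.\<close>

definition hpb_htpy :: "real \<times> ('a \<times> (real \<Rightarrow> 'x) \<times> 'b) \<Rightarrow> 'x" where
  "hpb_htpy = (\<lambda>(t, (a, p, b)). p t)"

text \<open>The whisker map of \<open>a\<close>, \<open>b\<close> and a homotopy \<open>h\<close> from \<open>u \<circ> a\<close> to \<open>v \<circ> b\<close>.\<close>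

definition hpb_whisker ::
  "('w \<Rightarrow> 'a) \<Rightarrow> ('w \<Rightarrow> 'b) \<Rightarrow> (real \<times> 'w \<Rightarrow> 'x) \<Rightarrow> 'w \<Rightarrow> 'a \<times> (real \<Rightarrow> 'x) \<times> 'b" where
  "hpb_whisker a b h w = (a w, (\<lambda>t\<in>{0..1}. h (t, w)), b w)"


subsection \<open>Homotopy pushouts\<close>

text \<open>
  Points of the reduced double mapping cylinder of \<open>\<eta>: W \<rightarrow> A\<close> and \<open>\<beta>: W \<rightarrow> B\<close>, that is, of the
  quotient of \<open>A \<squnion> ({0..1} \<times> W) \<squnion> B\<close> identifying \<open>(0, w)\<close> with \<open>\<eta> w\<close>, \<open>(1, w)\<close> with \<open>\<beta> w\<close>, and all
  \<open>(t, pbase W)\<close> with each other.  Every class has exactly one representative of the form \<open>DL a\<close>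
  with \<open>a \<in> A\<close>, or \<open>DR b\<close> with \<open>b \<in> B\<close> not the base point, or \<open>DC t w\<close> with \<open>0 < t < 1\<close> and
  \<open>w \<in> W\<close> not the base point.
\<close>

datatype ('w, 'a, 'b) dcyl = DL 'a | DR 'b | DC real 'w

definition hpo_inl :: "'a \<Rightarrow> ('w, 'a, 'b) dcyl" where
  "hpo_inl a = DL a"

definition hpo_inr :: "'a pspace \<Rightarrow> 'b pspace \<Rightarrow> 'b \<Rightarrow> ('w, 'a, 'b) dcyl" where
  "hpo_inr A B b = (if b = pbase B then DL (pbase A) else DR b)"

text \<open>
  The projection from \<open>{0..1} \<times> W\<close>; it is the homotopy from \<open>hpo_inl \<circ> \<eta>\<close> to \<open>hpo_inr A B \<circ> \<beta>\<close>
  that comes with the homotopy pushout.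
\<close>

definition hpo_htpy ::
  "'w pspace \<Rightarrow> 'a pspace \<Rightarrow> 'b pspace \<Rightarrow> ('w \<Rightarrow> 'a) \<Rightarrow> ('w \<Rightarrow> 'b) \<Rightarrow>
     real \<times> 'w \<Rightarrow> ('w, 'a, 'b) dcyl" where
  "hpo_htpy W A B \<eta> \<beta> = (\<lambda>(t, w).
     if t = 0 then hpo_inl (\<eta> w)
     else if t = 1 then hpo_inr A B (\<beta> w)
     else if w = pbase W then DL (pbase A)
     else DC t w)"

definition hpo_points ::
  "'w pspace \<Rightarrow> 'a pspace \<Rightarrow> 'b pspace \<Rightarrow> ('w \<Rightarrow> 'a) \<Rightarrow> ('w \<Rightarrow> 'b) \<Rightarrow>
     ('w, 'a, 'b) dcyl set" where
  "hpo_points W A B \<eta> \<beta> =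
     hpo_inl ` pts A \<union> hpo_inr A B ` pts B \<union> hpo_htpy W A B \<eta> \<beta> ` ({0..1} \<times> pts W)"

text \<open>The quotient topology of the disjoint union of \<open>A\<close>, \<open>{0..1} \<times> W\<close> and \<open>B\<close>.\<close>

definition hpo_open ::
  "'w pspace \<Rightarrow> 'a pspace \<Rightarrow> 'b pspace \<Rightarrow> ('w \<Rightarrow> 'a) \<Rightarrow> ('w \<Rightarrow> 'b) \<Rightarrow>
     ('w, 'a, 'b) dcyl set \<Rightarrow> bool" where
  "hpo_open W A B \<eta> \<beta> U \<longleftrightarrow> U \<subseteq> hpo_points W A B \<eta> \<beta> \<and>
     openin (ptop A) {a \<in> pts A. hpo_inl a \<in> U} \<and>
     openin (ptop B) {b \<in> pts B. hpo_inr A B b \<in> U} \<and>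
     openin (prod_topology (top_of_set {0..1}) (ptop W))
       {z \<in> {0..1} \<times> pts W. hpo_htpy W A B \<eta> \<beta> z \<in> U}"

definition hpo ::
  "'w pspace \<Rightarrow> 'a pspace \<Rightarrow> 'b pspace \<Rightarrow> ('w \<Rightarrow> 'a) \<Rightarrow> ('w \<Rightarrow> 'b) \<Rightarrow>
     ('w, 'a, 'b) dcyl pspace" where
  "hpo W A B \<eta> \<beta> = PSpace (topology (hpo_open W A B \<eta> \<beta>)) (hpo_inl (pbase A))"

lemma istopology_hpo_open: "istopology (hpo_open W A B \<eta> \<beta>)"
  unfolding istopology_def
proof (intro conjI allI impI)
  fix S T assume S: "hpo_open W A B \<eta> \<beta> S" and T: "hpo_open W A B \<eta> \<beta> T"
  have *: "{x \<in> M. g x \<in> S \<inter> T} = {x \<in> M. g x \<in> S} \<inter> {x \<in> M. g x \<in> T}"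
    for M :: "'z set" and g
    by auto
  show "hpo_open W A B \<eta> \<beta> (S \<inter> T)"
    using S T unfolding hpo_open_def * by (auto intro: openin_Int)
next
  fix K assume K: "\<forall>S\<in>K. hpo_open W A B \<eta> \<beta> S"
  have *: "{x \<in> M. g x \<in> \<Union>K} = (\<Union>S\<in>K. {x \<in> M. g x \<in> S})" for M :: "'z set" and g
    by auto
  show "hpo_open W A B \<eta> \<beta> (\<Union>K)"
    using K unfolding hpo_open_def * by (auto intro!: openin_Union)
qed

lemma openin_hpo: "openin (ptop (hpo W A B \<eta> \<beta>)) U \<longleftrightarrow> hpo_open W A B \<eta> \<beta> U"
  by (simp add: hpo_def topology_inverse' istopology_hpo_open)

text \<open>The whisker map of \<open>a\<close>, \<open>b\<close> and a homotopy \<open>h\<close> from \<open>a \<circ> \<eta>\<close> to \<open>b \<circ> \<beta>\<close>.\<close>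

definition hpo_whisker ::
  "('a \<Rightarrow> 'z) \<Rightarrow> ('b \<Rightarrow> 'z) \<Rightarrow> (real \<times> 'w \<Rightarrow> 'z) \<Rightarrow> ('w, 'a, 'b) dcyl \<Rightarrow> 'z" where
  "hpo_whisker a b h z = (case z of DL x \<Rightarrow> a x | DR y \<Rightarrow> b y | DC t w \<Rightarrow> h (t, w))"

text \<open>
  A square with corners \<open>W\<close>, \<open>A\<close>, \<open>B\<close>, \<open>S\<close>, commuting up to the chosen homotopy \<open>H\<close> from \<open>u \<circ> \<eta>\<close>
  to \<open>v \<circ> \<beta>\<close>, is a homotopy pushout if the comparison map from the standard homotopy pushout to
  \<open>S\<close> is a homotopy equivalence.
\<close>

definition hpushout_square ::
  "'w pspace \<Rightarrow> 'a pspace \<Rightarrow> 'b pspace \<Rightarrow> 's pspace \<Rightarrow> ('w \<Rightarrow> 'a) \<Rightarrow> ('w \<Rightarrow> 'b) \<Rightarrow>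
     ('a \<Rightarrow> 's) \<Rightarrow> ('b \<Rightarrow> 's) \<Rightarrow> (real \<times> 'w \<Rightarrow> 's) \<Rightarrow> bool" where
  "hpushout_square W A B S \<eta> \<beta> u v H \<longleftrightarrow>
     pmap W A \<eta> \<and> pmap W B \<beta> \<and> pmap A S u \<and> pmap B S v \<and>
     phomotopy W S (u \<circ> \<eta>) (v \<circ> \<beta>) H \<and>
     phomotopy_equivalence (hpo W A B \<eta> \<beta>) S (hpo_whisker u v H)"

text \<open>
  The whisker map \<open>S \<rightarrow> Z\<close> out of the homotopy pushout \<open>S\<close> of such a square, for \<open>a: A \<rightarrow> Z\<close>,
  \<open>b: B \<rightarrow> Z\<close> and a homotopy \<open>h\<close> from \<open>a \<circ> \<eta>\<close> to \<open>b \<circ> \<beta>\<close>.  It is determined up to homotopy by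
  the requirement that its composite with the comparison map be the standard whisker map.
\<close>

definition hpushout_whisker ::
  "'w pspace \<Rightarrow> 'a pspace \<Rightarrow> 'b pspace \<Rightarrow> 's pspace \<Rightarrow> ('w \<Rightarrow> 'a) \<Rightarrow> ('w \<Rightarrow> 'b) \<Rightarrow>
     ('a \<Rightarrow> 's) \<Rightarrow> ('b \<Rightarrow> 's) \<Rightarrow> (real \<times> 'w \<Rightarrow> 's) \<Rightarrow>
     'z pspace \<Rightarrow> ('a \<Rightarrow> 'z) \<Rightarrow> ('b \<Rightarrow> 'z) \<Rightarrow> (real \<times> 'w \<Rightarrow> 'z) \<Rightarrow> 's \<Rightarrow> 'z" where
  "hpushout_whisker W A B S \<eta> \<beta> u v H Z a b h = (SOME \<omega>.
     pmap S Z \<omega> \<and>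
     phomotopic (hpo W A B \<eta> \<beta>) Z (\<omega> \<circ> hpo_whisker u v H) (hpo_whisker a b h))"


subsection \<open>The Ganea construction\<close>

text \<open>
  A single type for the points of all the \<open>G\<^sub>i\<close>: the space \<open>G\<^sub>0\<close> is \<open>A\<close> with points
  tagged by \<open>GBase\<close>, and \<open>G\<^sub>i\<^sub>+\<^sub>1\<close> is the standard homotopy pushout with points tagged
  by \<open>GStep\<close>.
\<close>

datatype ('a, 'x) gan =
    GBase (un_GBase: 'a)
  | GStep (un_GStep: "('a \<times> (real \<Rightarrow> 'x) \<times> ('a, 'x) gan, 'a, ('a, 'x) gan) dcyl")

text \<open>The copy of \<open>P\<close> along an injection \<open>tag\<close> with left inverse \<open>untag\<close>.\<close>

definition tagged :: "('a \<Rightarrow> 'b) \<Rightarrow> ('b \<Rightarrow> 'a) \<Rightarrow> 'a pspace \<Rightarrow> 'b pspace" where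
  "tagged tag untag P = PSpace (pullback_topology (range tag) untag (ptop P)) (tag (pbase P))"

primrec ganea ::
  "'a pspace \<Rightarrow> 'x pspace \<Rightarrow> ('a \<Rightarrow> 'x) \<Rightarrow> nat \<Rightarrow>
     ('a, 'x) gan pspace \<times> (('a, 'x) gan \<Rightarrow> 'x)" where
  "ganea A X \<iota> 0 = (tagged GBase un_GBase A, \<iota> \<circ> un_GBase)"
| "ganea A X \<iota> (Suc i) =
     (let G = fst (ganea A X \<iota> i); g = snd (ganea A X \<iota> i); F = hpb A G X \<iota> g
      in (tagged GStep un_GStep (hpo F A G hpb_fst hpb_snd),
          hpo_whisker \<iota> g hpb_htpy \<circ> un_GStep))"

definition gan_G :: "'a pspace \<Rightarrow> 'x pspace \<Rightarrow> ('a \<Rightarrow> 'x) \<Rightarrow> nat \<Rightarrow> ('a, 'x) gan pspace" where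
  "gan_G A X \<iota> i = fst (ganea A X \<iota> i)"

definition gan_g :: "'a pspace \<Rightarrow> 'x pspace \<Rightarrow> ('a \<Rightarrow> 'x) \<Rightarrow> nat \<Rightarrow> ('a, 'x) gan \<Rightarrow> 'x" where
  "gan_g A X \<iota> i = snd (ganea A X \<iota> i)"

definition gan_F ::
  "'a pspace \<Rightarrow> 'x pspace \<Rightarrow> ('a \<Rightarrow> 'x) \<Rightarrow> nat \<Rightarrow>
     ('a \<times> (real \<Rightarrow> 'x) \<times> ('a, 'x) gan) pspace" where
  "gan_F A X \<iota> i = hpb A (gan_G A X \<iota> i) X \<iota> (gan_g A X \<iota> i)"

definition gan_alpha :: "nat \<Rightarrow> 'a \<Rightarrow> ('a, 'x) gan" where
  "gan_alpha i = (case i of 0 \<Rightarrow> GBase | Suc j \<Rightarrow> GStep \<circ> hpo_inl)"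

definition gan_gamma ::
  "'a pspace \<Rightarrow> 'x pspace \<Rightarrow> ('a \<Rightarrow> 'x) \<Rightarrow> nat \<Rightarrow> ('a, 'x) gan \<Rightarrow> ('a, 'x) gan" where
  "gan_gamma A X \<iota> i = GStep \<circ> hpo_inr A (gan_G A X \<iota> i)"

text \<open>
  The homotopy from \<open>\<alpha>\<^sub>i\<^sub>+\<^sub>1 \<circ> hpb_fst\<close> to \<open>\<gamma>\<^sub>i \<circ> hpb_snd\<close> of the pushout
  square defining \<open>G\<^sub>i\<^sub>+\<^sub>1\<close>.
\<close>

definition gan_htpy ::
  "'a pspace \<Rightarrow> 'x pspace \<Rightarrow> ('a \<Rightarrow> 'x) \<Rightarrow> nat \<Rightarrow>
     real \<times> ('a \<times> (real \<Rightarrow> 'x) \<times> ('a, 'x) gan) \<Rightarrow> ('a, 'x) gan" where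
  "gan_htpy A X \<iota> i = GStep \<circ> hpo_htpy (gan_F A X \<iota> i) A (gan_G A X \<iota> i) hpb_fst hpb_snd"

text \<open>\<open>gan_gammas A X \<iota> i d\<close> is the composite \<open>G\<^sub>i \<rightarrow> G\<^sub>j\<close> of the maps \<open>\<gamma>\<close>, for \<open>j = i + d\<close>.\<close>

primrec gan_gammas ::
  "'a pspace \<Rightarrow> 'x pspace \<Rightarrow> ('a \<Rightarrow> 'x) \<Rightarrow> nat \<Rightarrow> nat \<Rightarrow> ('a, 'x) gan \<Rightarrow> ('a, 'x) gan" where
  "gan_gammas A X \<iota> i 0 = id"
| "gan_gammas A X \<iota> i (Suc d) = gan_gamma A X \<iota> (i + d) \<circ> gan_gammas A X \<iota> i d"


subsection \<open>Sectional and relative categories\<close>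

text \<open>The infimum in \<^typ>\<open>enat\<close> of the empty set is \<open>\<infinity>\<close>.\<close>

definition least_enat :: "(nat \<Rightarrow> bool) \<Rightarrow> enat" where
  "least_enat P = Inf (enat ` {n. P n})"

definition secat :: "'a pspace \<Rightarrow> 'x pspace \<Rightarrow> ('a \<Rightarrow> 'x) \<Rightarrow> enat" where
  "secat A X \<iota> = least_enat (\<lambda>n. \<exists>\<sigma>. homotopy_section (gan_G A X \<iota> n) X (gan_g A X \<iota> n) \<sigma>)"

definition relcat :: "'a pspace \<Rightarrow> 'x pspace \<Rightarrow> ('a \<Rightarrow> 'x) \<Rightarrow> enat" where
  "relcat A X \<iota> = least_enat (\<lambda>n. \<exists>\<sigma>.
     homotopy_section (gan_G A X \<iota> n) X (gan_g A X \<iota> n) \<sigma> \<and>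
     phomotopic A (gan_G A X \<iota> n) (\<sigma> \<circ> \<iota>) (gan_alpha n))"

definition relcat_k :: "nat \<Rightarrow> 'a pspace \<Rightarrow> 'x pspace \<Rightarrow> ('a \<Rightarrow> 'x) \<Rightarrow> enat" where
  "relcat_k k A X \<iota> = least_enat (\<lambda>n. n \<ge> k \<and> (\<exists>\<sigma>.
     homotopy_section (gan_G A X \<iota> n) X (gan_g A X \<iota> n) \<sigma> \<and>
     phomotopic (gan_G A X \<iota> k) (gan_G A X \<iota> n)
       (\<sigma> \<circ> gan_g A X \<iota> k) (gan_gammas A X \<iota> k (n - k))))"


subsection \<open>Hopf category\<close>

text \<open>
  In the following, \<open>S\<close> is the homotopy pushout of \<open>\<eta>, \<beta>: W \<rightarrow> A\<close> with both structure maps \<open>\<theta>\<close> and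
  homotopy \<open>H\<close> from \<open>\<theta> \<circ> \<eta>\<close> to \<open>\<theta> \<circ> \<beta>\<close>, and \<open>f: S \<rightarrow> X\<close>.

  The map \<open>W \<rightarrow> F\<^sub>m\<close> with components \<open>\<eta>\<close> and \<open>\<alpha>\<^sub>m \<circ> \<beta>\<close>.  In the present model \<open>g\<^sub>m \<circ> \<alpha>\<^sub>m\<close> equals
  \<open>f \<circ> \<theta>\<close> on the nose, so \<open>f \<circ> H\<close> is the required homotopy from \<open>f \<circ> \<theta> \<circ> \<eta>\<close> to
  \<open>g\<^sub>m \<circ> \<alpha>\<^sub>m \<circ> \<beta>\<close>.
\<close>

definition hopf_whisker ::
  "('w \<Rightarrow> 'a) \<Rightarrow> ('w \<Rightarrow> 'a) \<Rightarrow> (real \<times> 'w \<Rightarrow> 's) \<Rightarrow> ('s \<Rightarrow> 'x) \<Rightarrow> nat \<Rightarrow>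
     'w \<Rightarrow> 'a \<times> (real \<Rightarrow> 'x) \<times> ('a, 'x) gan" where
  "hopf_whisker \<eta> \<beta> H f m = hpb_whisker \<eta> (gan_alpha m \<circ> \<beta>) (f \<circ> H)"

text \<open>The map \<open>\<omega>\<^sub>n: S \<rightarrow> G\<^sub>n\<close>; it is used for \<open>n \<ge> 1\<close> only.\<close>

definition hopf_omega ::
  "'w pspace \<Rightarrow> 'a pspace \<Rightarrow> 's pspace \<Rightarrow> 'x pspace \<Rightarrow> ('w \<Rightarrow> 'a) \<Rightarrow> ('w \<Rightarrow> 'a) \<Rightarrow> ('a \<Rightarrow> 's) \<Rightarrow>
     (real \<times> 'w \<Rightarrow> 's) \<Rightarrow> ('s \<Rightarrow> 'x) \<Rightarrow> nat \<Rightarrow> 's \<Rightarrow> ('a, 'x) gan" where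
  "hopf_omega W A S X \<eta> \<beta> \<theta> H f n = (let \<iota> = f \<circ> \<theta>; m = n - 1 in
     hpushout_whisker W A A S \<eta> \<beta> \<theta> \<theta> H (gan_G A X \<iota> n)
       (gan_alpha n)
       (gan_gamma A X \<iota> m \<circ> gan_alpha m)
       (\<lambda>(t, w). gan_htpy A X \<iota> m (t, hopf_whisker \<eta> \<beta> H f m w)))"

definition hcat ::
  "'w pspace \<Rightarrow> 'a pspace \<Rightarrow> 's pspace \<Rightarrow> 'x pspace \<Rightarrow> ('w \<Rightarrow> 'a) \<Rightarrow> ('w \<Rightarrow> 'a) \<Rightarrow> ('a \<Rightarrow> 's) \<Rightarrow>
     (real \<times> 'w \<Rightarrow> 's) \<Rightarrow> ('s \<Rightarrow> 'x) \<Rightarrow> enat" where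
  "hcat W A S X \<eta> \<beta> \<theta> H f = (let \<iota> = f \<circ> \<theta> in least_enat (\<lambda>n. n \<ge> 1 \<and> (\<exists>\<sigma>.
     homotopy_section (gan_G A X \<iota> n) X (gan_g A X \<iota> n) \<sigma> \<and>
     phomotopic S (gan_G A X \<iota> n) (\<sigma> \<circ> f) (hopf_omega W A S X \<eta> \<beta> \<theta> H f n))))"

end

theory Submission
  imports Defs
begin

text \<open>
  Write \<open>\<iota> = f \<circ> \<theta>\<close>.  The space \<open>G\<^sub>n\<^sub>+\<^sub>1\<close> is the fibrewise join over \<open>X\<close> of \<open>A\<close> and \<open>G\<^sub>n\<close>: its points are
  points of \<open>A\<close>, points of \<open>G\<^sub>n\<close>, and points \<open>c(t, (a, p, b))\<close> on a line that joins \<open>a\<close> to \<open>b\<close> for each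
  path \<open>p\<close> in \<open>X\<close> from \<open>\<iota> a\<close> to \<open>g\<^sub>n b\<close>.  A map from a double mapping cylinder of \<open>\<eta>: W \<rightarrow> A\<close> and
  \<open>\<beta>: W \<rightarrow> B\<close> into such a join is given by a map \<open>k: B \<rightarrow> G\<^sub>n\<close> and a homotopy \<open>Q\<close> from \<open>\<iota> \<circ> \<eta>\<close> to
  \<open>g\<^sub>n \<circ> k \<circ> \<beta>\<close> (\<open>square_map\<close>); up to homotopy, \<open>\<omega>\<^sub>n\<close> and the composites of the maps
  \<open>\<gamma>\<close> have this form.  Such maps are homotopic when their data \<open>(k, Q)\<close> are (\<open>square_map_phomotopic\<close>).  The
  one further source of homotopies is \<open>inr_phomotopic_square_map\<close>: if \<open>\<phi>\<close> maps the cylinder to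
  \<open>G\<^sub>n\<close>, then after inclusion into the join \<open>\<phi>\<close> can be pushed along the join lines, and becomes
  the map with \<open>k = \<phi>|B\<close> and with \<open>Q\<close> the image in \<open>X\<close> of the lines of the cylinder.
\<close>

text \<open>
  The first two inequalities are formal: \<open>\<theta>\<close> induces maps \<open>G\<^sub>n(\<iota>) \<rightarrow> G\<^sub>n(f)\<close> over \<open>X\<close>, and
  \<open>\<omega>\<^sub>n \<circ> \<theta> \<simeq> \<alpha>\<^sub>n\<close>.  For the third one, \<open>\<gamma>\<^sub>n \<circ> \<omega>\<^sub>n \<simeq> \<omega>\<^sub>n\<^sub>+\<^sub>1\<close> by \<open>inr_square_map_phomotopic\<close>,
  and \<open>g\<^sub>1 \<circ> \<omega>\<^sub>1 \<simeq> f\<close>; hence \<open>\<sigma> \<circ> g\<^sub>1 \<simeq> \<gamma>\<^sub>1\<^sub>,\<^sub>n\<close> gives \<open>\<sigma> \<circ> f \<simeq> \<gamma>\<^sub>1\<^sub>,\<^sub>n \<circ> \<omega>\<^sub>1 \<simeq> \<omega>\<^sub>n\<close>.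
\<close>

text \<open>
  For the last one, let \<open>\<sigma>\<close> be a homotopy section of \<open>g\<^sub>n\<close> with \<open>\<sigma> \<circ> \<iota> \<simeq> \<alpha>\<^sub>n\<close>; then
  \<open>\<gamma>\<^sub>n \<circ> \<sigma> \<circ> g\<^sub>1 \<simeq> \<gamma>\<^sub>1\<^sub>,\<^sub>n\<^sub>+\<^sub>1\<close> has to be shown.  Pushing along the join lines turns the left side into a
  map with \<open>k = \<alpha>\<^sub>n\<close>, up to homotopy.  Its \<open>Q\<close> is the tautological path \<open>p\<close> followed by a loop
  \<open>\<delta>\<close>: the homotopies \<open>g\<^sub>n \<circ> \<sigma> \<simeq> id\<close> and \<open>\<sigma> \<circ> \<iota> \<simeq> \<alpha>\<^sub>n\<close> need not be compatible, and their
  discrepancy over \<open>\<iota>\<close> is a self-homotopy \<open>\<delta>\<close> of \<open>\<iota>\<close>.  If \<open>n \<ge> 1\<close>, the loop can be absorbed: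
  \<open>\<alpha>\<^sub>n\<close> is homotopic to \<open>\<gamma>\<^sub>n\<^sub>-\<^sub>1 \<circ> \<alpha>\<^sub>n\<^sub>-\<^sub>1\<close> by a join line lying over any prescribed loop at
  \<open>\<iota> b\<close>, in particular over \<open>\<delta>\<close> (\<open>inl_inr_phomotopic\<close>, \<open>inr_section_phomotopic_square_map\<close>).  If \<open>n = 0\<close>
  there is no room for this, but appending \<open>\<delta>\<close> is an equivalence of \<open>G\<^sub>1\<close>, whose inverse appends the
  reversed loop.  So \<open>g\<^sub>1\<close> has a homotopy left inverse; its homotopy section \<open>\<gamma>\<^sub>0 \<circ> \<sigma>\<close> is then a
  two-sided inverse (\<open>inr_section_phomotopic_id\<close>).
\<close>

section \<open>Pointed homotopies\<close>

abbreviation I01 :: "real topology" where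
  "I01 \<equiv> top_of_set {0..1}"

lemma continuous_map_app:
  assumes "continuous_map P R f" "continuous_map Z P a"
  shows "continuous_map Z R (\<lambda>z. f (a z))"
  using continuous_map_compose[OF assms(2,1)] by (simp add: o_def)

lemma continuous_map_app2:
  assumes "continuous_map (prod_topology P Q) R f" "continuous_map Z P a" "continuous_map Z Q b"
  shows "continuous_map Z R (\<lambda>z. f (a z, b z))"
  by (rule continuous_map_app[OF assms(1)]) (intro continuous_map_pairedI assms)

lemma continuous_map_into_I01:
  "continuous_map Z I01 f \<longleftrightarrow>
     continuous_map Z euclideanreal f \<and> (\<forall>z\<in>topspace Z. f z \<in> {0..1})"
  by (auto simp: continuous_map_in_subtopology)

lemma continuous_map_triple_projections:
  "continuous_map (prod_topology P (prod_topology Q R)) Q (\<lambda>z. fst (snd z))"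
  "continuous_map (prod_topology P (prod_topology Q R)) R (\<lambda>z. snd (snd z))"
  by (rule continuous_map_app[OF continuous_map_fst continuous_map_snd],
      rule continuous_map_app[OF continuous_map_snd continuous_map_snd])

lemma pmapD:
  assumes "pmap P Q f"
  shows "continuous_map (ptop P) (ptop Q) f" "f (pbase P) = pbase Q"
    "\<And>x. x \<in> pts P \<Longrightarrow> f x \<in> pts Q"
  using assms by (auto simp: pmap_def continuous_map_def)

lemma pmap_id: "pmap P P id"
  by (simp add: pmap_def)

lemma pmap_comp: "pmap P Q f \<Longrightarrow> pmap Q R g \<Longrightarrow> pmap P R (g \<circ> f)"
  by (auto simp: pmap_def intro: continuous_map_compose)

lemma phomotopyD:
  assumes "phomotopy P Q f g h"
  shows "continuous_map (prod_topology I01 (ptop P)) (ptop Q) h"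
    "\<And>x. x \<in> pts P \<Longrightarrow> h (0, x) = f x" "\<And>x. x \<in> pts P \<Longrightarrow> h (1, x) = g x"
    "\<And>t. 0 \<le> t \<Longrightarrow> t \<le> 1 \<Longrightarrow> h (t, pbase P) = pbase Q"
    "\<And>t x. 0 \<le> t \<Longrightarrow> t \<le> 1 \<Longrightarrow> x \<in> pts P \<Longrightarrow> h (t, x) \<in> pts Q"
  using assms by (auto simp: phomotopy_def continuous_map_def)

text \<open>
  The library notion prescribes the end maps at all elements of the type; a chosen pointed
  homotopy only prescribes them on the underlying space.  The two agree because the side
  condition concerns the base point alone, which has to be a point of the space.
\<close>

lemma phomotopic_iff:
  assumes "pointed_space P"
  shows "phomotopic P Q f g \<longleftrightarrow> (\<exists>h. phomotopy P Q f g h)"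
  unfolding phomotopic_def phomotopy_def
  by (subst homotopic_with) (use assms in \<open>auto simp: pointed_space_def\<close>)

lemma phomotopicI: "pointed_space P \<Longrightarrow> phomotopy P Q f g h \<Longrightarrow> phomotopic P Q f g"
  by (auto simp: phomotopic_iff)

lemma phomotopic_refl: "pmap P Q f \<Longrightarrow> phomotopic P Q f f"
  by (simp add: phomotopic_def pmap_def)

lemma phomotopic_sym: "phomotopic P Q f g \<Longrightarrow> phomotopic P Q g f"
  by (simp add: phomotopic_def homotopic_with_sym)

lemma phomotopic_trans [trans]:
  "phomotopic P Q f g \<Longrightarrow> phomotopic P Q g k \<Longrightarrow> phomotopic P Q f k"
  unfolding phomotopic_def by (rule homotopic_with_trans)

lemma phomotopic_cong:
  assumes "pointed_space P" "phomotopic P Q f g"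
    and "\<And>x. x \<in> pts P \<Longrightarrow> f' x = f x" "\<And>x. x \<in> pts P \<Longrightarrow> g' x = g x"
  shows "phomotopic P Q f' g'"
  using assms unfolding phomotopic_iff[OF assms(1)] phomotopy_def by simp

lemma phomotopic_postcomp:
  assumes P: "pointed_space P" and h: "phomotopic P Q f g" and k: "pmap Q R k"
  shows "phomotopic P R (k \<circ> f) (k \<circ> g)"
proof -
  obtain h where "phomotopy P Q f g h" using h P by (auto simp: phomotopic_iff)
  then have "phomotopy P R (k \<circ> f) (k \<circ> g) (k \<circ> h)"
    using k by (auto simp: phomotopy_def pmap_def intro: continuous_map_compose)
  then show ?thesis by (rule phomotopicI[OF P])
qed

lemma phomotopic_precomp:
  assumes P: "pointed_space P" and Q: "pointed_space Q"
    and h: "phomotopic Q R f g" and k: "pmap P Q k"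
  shows "phomotopic P R (f \<circ> k) (g \<circ> k)"
proof -
  obtain h where h: "phomotopy Q R f g h" using h Q by (auto simp: phomotopic_iff)
  have "phomotopy P R (f \<circ> k) (g \<circ> k) (\<lambda>z. h (fst z, k (snd z)))"
    using phomotopyD[OF h] pmapD[OF k]
    by (auto simp: phomotopy_def
        intro!: continuous_map_app2[OF phomotopyD(1)[OF h]] continuous_map_fst
          continuous_map_app[OF pmapD(1)[OF k] continuous_map_snd])
  then show ?thesis by (rule phomotopicI[OF P])
qed

lemma phomotopy_pmap:
  assumes h: "phomotopy P Q f g h" and s: "0 \<le> s" "s \<le> 1"
  shows "pmap P Q (\<lambda>x. h (s, x))"
  unfolding pmap_def
  using continuous_map_app2[OF phomotopyD(1)[OF h], of "ptop P" "\<lambda>_. s" "\<lambda>x. x"]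
    phomotopyD(4)[OF h s] s by simp

lemma pmap_cong:
  "pmap P Q f \<Longrightarrow> pointed_space P \<Longrightarrow> (\<And>x. x \<in> pts P \<Longrightarrow> f x = g x) \<Longrightarrow> pmap P Q g"
  unfolding pmap_def pointed_space_def using continuous_map_eq by (metis (no_types, lifting))

lemma phomotopy_ends:
  assumes h: "phomotopy P Q f g h" and P: "pointed_space P"
  shows "pmap P Q f" "pmap P Q g"
  by (rule pmap_cong[OF phomotopy_pmap[OF h] P, of 0]; simp add: phomotopyD[OF h])
     (rule pmap_cong[OF phomotopy_pmap[OF h] P, of 1]; simp add: phomotopyD[OF h])

text \<open>
  If \<open>\<tau> \<circ> g \<simeq> id\<close> and \<open>g \<circ> \<sigma> \<simeq> id\<close>, then \<open>\<sigma> \<simeq> \<tau> \<circ> g \<circ> \<sigma> \<simeq> \<tau>\<close>.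
\<close>

lemma homotopy_section_left_inverse:
  assumes G: "pointed_space G" and X: "pointed_space X"
    and g: "pmap G X g" and \<sigma>: "homotopy_section G X g \<sigma>"
    and \<tau>: "pmap X G \<tau>" "phomotopic G G (\<tau> \<circ> g) id"
  shows "phomotopic G G (\<sigma> \<circ> g) id"
proof -
  have \<sigma>': "pmap X G \<sigma>" "phomotopic X X (g \<circ> \<sigma>) id"
    using \<sigma> by (auto simp: homotopy_section_def)
  have "phomotopic X G (\<tau> \<circ> (g \<circ> \<sigma>)) (\<tau> \<circ> id)"
    by (rule phomotopic_postcomp[OF X \<sigma>'(2) \<tau>(1)])
  moreover have "phomotopic X G ((\<tau> \<circ> g) \<circ> \<sigma>) (id \<circ> \<sigma>)"
    by (rule phomotopic_precomp[OF X G \<tau>(2) \<sigma>'(1)])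
  ultimately have "phomotopic X G \<sigma> \<tau>"
    by (metis comp_assoc comp_id id_comp phomotopic_sym phomotopic_trans)
  then have "phomotopic G G (\<sigma> \<circ> g) (\<tau> \<circ> g)"
    by (rule phomotopic_precomp[OF G X _ g])
  then show ?thesis using \<tau>(2) by (rule phomotopic_trans)
qed

section \<open>Path spaces and homotopy pullbacks\<close>

lemma topspace_path_topology [simp]: "topspace (path_topology X) = path_set X"
proof -
  have "path_set X \<in> {{p \<in> path_set X. p ` K \<subseteq> U} | K U. compact K \<and> K \<subseteq> {0..1} \<and> openin X U}"
    by (auto intro!: exI[of _ "{}"])
  then show ?thesis unfolding path_topology_def topology_generated_by_topspace by blast
qed

lemma path_setD:
  assumes "p \<in> path_set X"
  shows "continuous_map I01 X p" "(\<lambda>t\<in>{0..1}. p t) = p"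
  using assms by (auto simp: path_set_def pathin_def extensional_restrict)

text \<open>
  Evaluation is continuous because the unit interval is locally compact; together with currying
  it makes maps into the path space the same as homotopies.
\<close>

lemma continuous_map_path_evaluation:
  "continuous_map (prod_topology I01 (path_topology X)) X (\<lambda>z. (snd z) (fst z))"
  unfolding continuous_map_def
proof (intro conjI allI impI)
  show "(\<lambda>z. (snd z) (fst z)) \<in> topspace (prod_topology I01 (path_topology X)) \<rightarrow> topspace X"
    using path_setD(1)[of _ X] by (fastforce simp: continuous_map_def)
  fix U assume U: "openin X U"
  let ?E = "{z \<in> topspace (prod_topology I01 (path_topology X)). snd z (fst z) \<in> U}"
  show "openin (prod_topology I01 (path_topology X)) ?E"
  proof (subst openin_subopen, intro ballI)
    fix z assume z: "z \<in> ?E"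
    obtain t p where [simp]: "z = (t, p)" by (cases z)
    have t: "t \<in> {0..1}" and p: "p \<in> path_set X" and tU: "p t \<in> U"
      using z by auto
    have "openin I01 {s \<in> topspace I01. p s \<in> U}"
      by (rule openin_continuous_map_preimage[OF path_setD(1)[OF p] U])
    then obtain V where V: "open V" "{s \<in> {0..1}. p s \<in> U} = {0..1} \<inter> V"
      by (auto simp: openin_open)
    then have "t \<in> V" using t tU by blast
    then obtain e where e: "e > 0" "cball t e \<subseteq> V"
      using V(1) open_contains_cball by blast
    \<comment> \<open>a compact neighbourhood of \<open>t\<close> on which the path stays in \<open>U\<close>\<close>
    define K where "K = {0..1} \<inter> cball t e"
    define N where "N = {q \<in> path_set X. q ` K \<subseteq> U}"
    have "openin (path_topology X) N"
      unfolding path_topology_def N_def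
      by (rule topology_generated_by_Basis) (use U in \<open>auto simp: K_def compact_Int\<close>)
    moreover have "openin I01 ({0..1} \<inter> ball t e)"
      by (auto simp: openin_open)
    ultimately have "openin (prod_topology I01 (path_topology X)) (({0..1} \<inter> ball t e) \<times> N)"
      by (simp add: openin_prod_Times_iff)
    moreover have "z \<in> ({0..1} \<inter> ball t e) \<times> N"
      using t p e V(2) by (auto simp: N_def K_def)
    moreover have "({0..1} \<inter> ball t e) \<times> N \<subseteq> ?E"
      by (auto simp: N_def K_def image_subset_iff)
    ultimately show "\<exists>T. openin (prod_topology I01 (path_topology X)) T \<and> z \<in> T \<and> T \<subseteq> ?E"
      by blast
  qed
qed

text \<open>
  The preimage of a subbasic set is open by the tube lemma for the compact set \<open>K\<close>.
\<close>

lemma continuous_map_path_curry: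
  assumes h: "continuous_map (prod_topology I01 Z) X h"
  shows "continuous_map Z (path_topology X) (\<lambda>z. \<lambda>t\<in>{0..1}. h (t, z))"
  unfolding path_topology_def
proof (rule continuous_on_generated_topo)
  have pth: "(\<lambda>t\<in>{0..1}. h (t, z)) \<in> path_set X" if "z \<in> topspace Z" for z
  proof -
    have "continuous_map I01 X (\<lambda>t. h (t, z))"
      by (rule continuous_map_app2[OF h]) (use that in auto)
    then have "continuous_map I01 X (\<lambda>t\<in>{0..1}. h (t, z))"
      by (rule continuous_map_eq) auto
    then show ?thesis by (simp add: path_set_def pathin_def)
  qed
  then show "(\<lambda>z. \<lambda>t\<in>{0..1}. h (t, z)) ` topspace Z \<subseteq>
      \<Union>{{p \<in> path_set X. p ` K \<subseteq> U} | K U. compact K \<and> K \<subseteq> {0..1} \<and> openin X U}"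
    using topspace_path_topology[of X]
    unfolding path_topology_def topology_generated_by_topspace by auto
  fix B assume "B \<in> {{p \<in> path_set X. p ` K \<subseteq> U} | K U. compact K \<and> K \<subseteq> {0..1} \<and> openin X U}"
  then obtain K U where B: "B = {p \<in> path_set X. p ` K \<subseteq> U}"
    and K: "compact K" "K \<subseteq> {0..1}" and U: "openin X U" by auto
  let ?O = "{z \<in> topspace (prod_topology I01 Z). h z \<in> U}"
  have O: "openin (prod_topology I01 Z) ?O"
    by (rule openin_continuous_map_preimage[OF h U])
  have Kc: "compactin I01 K"
    using K by (simp add: compactin_subtopology)
  show "openin Z ((\<lambda>z. \<lambda>t\<in>{0..1}. h (t, z)) -` B \<inter> topspace Z)"
  proof (subst openin_subopen, intro ballI)
    fix z assume z: "z \<in> (\<lambda>z. \<lambda>t\<in>{0..1}. h (t, z)) -` B \<inter> topspace Z"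
    then have "K \<times> {z} \<subseteq> ?O" using K(2) by (auto simp: B image_subset_iff subset_iff)
    then obtain N V where V: "openin Z V" "K \<subseteq> N" "z \<in> V" "N \<times> V \<subseteq> ?O"
      using tube_lemma_left[OF O Kc, of z] z by auto
    then have "V \<subseteq> (\<lambda>z. \<lambda>t\<in>{0..1}. h (t, z)) -` B \<inter> topspace Z"
      using pth openin_subset[OF V(1)] K(2) by (auto simp: B subset_iff)
    then show "\<exists>T. openin Z T \<and> z \<in> T \<and> T \<subseteq> (\<lambda>z. \<lambda>t\<in>{0..1}. h (t, z)) -` B \<inter> topspace Z"
      using V by blast
  qed
qed

lemma topspace_hpb:
  "pts (hpb A B X u v) =
     {(a, p, b). a \<in> pts A \<and> p \<in> path_set (ptop X) \<and> b \<in> pts B \<and> p 0 = u a \<and> p 1 = v b}"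
  by (auto simp: hpb_def)

lemma pointed_hpb:
  assumes "pointed_space A" "pointed_space B" "pointed_space X" "pmap A X u" "pmap B X v"
  shows "pointed_space (hpb A B X u v)"
proof -
  have "continuous_map I01 (ptop X) (\<lambda>t\<in>{0..1}. pbase X)"
    by (rule continuous_map_eq[of _ _ "\<lambda>_. pbase X"])
       (use assms in \<open>auto simp: pointed_space_def\<close>)
  then show ?thesis
    using assms unfolding pointed_space_def topspace_hpb
    by (auto simp: hpb_def path_set_def pathin_def pmap_def)
qed

lemma pmap_hpb_fst: "pmap (hpb A B X u v) A hpb_fst"
  by (simp add: pmap_def hpb_def continuous_map_subtopology_fst)

lemma pmap_hpb_snd: "pmap (hpb A B X u v) B hpb_snd"
  by (simp add: pmap_def hpb_def continuous_map_from_subtopology continuous_map_triple_projections)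

lemma phomotopy_hpb_htpy:
  assumes "pmap A X u" "pmap B X v"
  shows "phomotopy (hpb A B X u v) X (u \<circ> hpb_fst) (v \<circ> hpb_snd) hpb_htpy"
proof -
  let ?F = "hpb A B X u v"
  have "continuous_map (prod_topology I01 (ptop ?F)) (path_topology (ptop X)) (\<lambda>z. fst (snd (snd z)))"
  proof (rule continuous_map_app[OF _ continuous_map_snd])
    show "continuous_map (ptop ?F) (path_topology (ptop X)) (\<lambda>z. fst (snd z))"
      by (simp add: hpb_def continuous_map_from_subtopology continuous_map_triple_projections)
  qed
  then have "continuous_map (prod_topology I01 (ptop ?F)) (ptop X) (\<lambda>z. fst (snd (snd z)) (fst z))"
    using continuous_map_app2[OF continuous_map_path_evaluation[of "ptop X"] continuous_map_fst]
    by simp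
  then show ?thesis
    unfolding phomotopy_def topspace_hpb
    by (auto simp: hpb_def hpb_htpy_def case_prod_unfold)
qed

text \<open>
  Here \<open>Z\<close> is an arbitrary space of parameters, so that the lemma also serves for families of
  whisker maps.
\<close>

lemma continuous_map_hpb_whisker:
  assumes a: "continuous_map Z (ptop A) a" and b: "continuous_map Z (ptop B) b"
    and h: "continuous_map (prod_topology I01 Z) (ptop X) h"
    and "\<And>z. z \<in> topspace Z \<Longrightarrow> h (0, z) = u (a z)" "\<And>z. z \<in> topspace Z \<Longrightarrow> h (1, z) = v (b z)"
  shows "continuous_map Z (ptop (hpb A B X u v)) (hpb_whisker a b h)"
proof -
  have "continuous_map Z (path_topology (ptop X)) (\<lambda>z. \<lambda>t\<in>{0..1}. h (t, z))"
    by (rule continuous_map_path_curry[OF h])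
  then have "continuous_map Z (prod_topology (ptop A) (prod_topology (path_topology (ptop X)) (ptop B)))
      (\<lambda>z. (a z, (\<lambda>t\<in>{0..1}. h (t, z)), b z))"
    by (intro continuous_map_pairedI a b)
  then show ?thesis
    using assms(4,5) unfolding hpb_def pspace.sel hpb_whisker_def
    by (auto simp: continuous_map_in_subtopology)
qed

lemma hpb_whisker_eqI:
  assumes "a z = a' z'" "b z = b' z'" "\<And>t. 0 \<le> t \<Longrightarrow> t \<le> 1 \<Longrightarrow> h (t, z) = h' (t, z')"
  shows "hpb_whisker a b h z = hpb_whisker a' b' h' z'"
  using assms by (auto simp: hpb_whisker_def restrict_def)

lemma hpb_whisker_base:
  assumes "a z = pbase A" "b z = pbase B" "\<And>t. 0 \<le> t \<Longrightarrow> t \<le> 1 \<Longrightarrow> h (t, z) = pbase X"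
  shows "hpb_whisker a b h z = pbase (hpb A B X u v)"
  using assms by (auto simp: hpb_whisker_def hpb_def restrict_def)

section \<open>Homotopy pushouts\<close>

lemma topspace_hpo:
  assumes "pmap W A \<eta>" "pmap W B \<beta>"
  shows "pts (hpo W A B \<eta> \<beta>) = hpo_points W A B \<eta> \<beta>"
proof -
  have "hpo_open W A B \<eta> \<beta> (hpo_points W A B \<eta> \<beta>)"
    unfolding hpo_open_def
  proof (intro conjI)
    have "{a \<in> pts A. hpo_inl a \<in> hpo_points W A B \<eta> \<beta>} = pts A"
      by (auto simp: hpo_points_def)
    then show "openin (ptop A) {a \<in> pts A. hpo_inl a \<in> hpo_points W A B \<eta> \<beta>}" by simp
    have "{b \<in> pts B. hpo_inr A B b \<in> hpo_points W A B \<eta> \<beta>} = pts B"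
      by (auto simp: hpo_points_def)
    then show "openin (ptop B) {b \<in> pts B. hpo_inr A B b \<in> hpo_points W A B \<eta> \<beta>}" by simp
    have "{z \<in> {0..1} \<times> pts W. hpo_htpy W A B \<eta> \<beta> z \<in> hpo_points W A B \<eta> \<beta>} =
        topspace (prod_topology I01 (ptop W))"
      by (auto simp: hpo_points_def)
    then show "openin (prod_topology I01 (ptop W))
        {z \<in> {0..1} \<times> pts W. hpo_htpy W A B \<eta> \<beta> z \<in> hpo_points W A B \<eta> \<beta>}"
      by (simp only: openin_topspace)
  qed auto
  moreover have "U \<subseteq> hpo_points W A B \<eta> \<beta>" if "hpo_open W A B \<eta> \<beta> U" for U
    using that by (simp add: hpo_open_def)
  ultimately show ?thesis
    unfolding topspace_def openin_hpo by blast
qed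

lemma pbase_hpo [simp]: "pbase (hpo W A B \<eta> \<beta>) = hpo_inl (pbase A)"
  by (simp add: hpo_def)

lemma pointed_hpo: "pointed_space A \<Longrightarrow> pmap W A \<eta> \<Longrightarrow> pmap W B \<beta> \<Longrightarrow> pointed_space (hpo W A B \<eta> \<beta>)"
  unfolding pointed_space_def by (simp add: topspace_hpo hpo_points_def)

lemma hpo_inr_base: "hpo_inr A B (pbase B) = hpo_inl (pbase A)"
  by (simp add: hpo_inr_def hpo_inl_def)

lemma hpo_htpy_simps:
  "hpo_htpy W A B \<eta> \<beta> (0, w) = hpo_inl (\<eta> w)"
  "hpo_htpy W A B \<eta> \<beta> (1, w) = hpo_inr A B (\<beta> w)"
  by (simp_all add: hpo_htpy_def)

text \<open>
  The values at \<open>t = 0\<close> and \<open>t = 1\<close> agree with the collapsed ones because \<open>\<eta>\<close> and \<open>\<beta>\<close> are pointed.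
\<close>

lemma hpo_htpy_base:
  assumes "pmap W A \<eta>" "pmap W B \<beta>"
  shows "hpo_htpy W A B \<eta> \<beta> (t, pbase W) = hpo_inl (pbase A)"
  using pmapD(2)[OF assms(1)] pmapD(2)[OF assms(2)] by (simp add: hpo_htpy_def hpo_inr_def hpo_inl_def)

lemma hpo_whisker_inl [simp]: "hpo_whisker a b h (hpo_inl x) = a x"
  by (simp add: hpo_whisker_def hpo_inl_def)

lemma hpo_whisker_inr:
  "a (pbase A) = b (pbase B) \<Longrightarrow> hpo_whisker a b h (hpo_inr A B x) = b x"
  by (simp add: hpo_whisker_def hpo_inr_def)

context
  fixes W :: "'w pspace" and A :: "'a pspace" and B :: "'b pspace" and \<eta> \<beta>
  assumes eta: "pmap W A \<eta>" and beta: "pmap W B \<beta>"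
begin

lemma hpo_point_cases [consumes 1, case_names inl inr htpy]:
  assumes "z \<in> pts (hpo W A B \<eta> \<beta>)"
  obtains a where "a \<in> pts A" "z = hpo_inl a"
  | b where "b \<in> pts B" "z = hpo_inr A B b"
  | t w where "0 \<le> t" "t \<le> 1" "w \<in> pts W" "z = hpo_htpy W A B \<eta> \<beta> (t, w)"
  using assms unfolding topspace_hpo[OF eta beta] hpo_points_def by auto

lemma pmap_hpo_inl: "pmap A (hpo W A B \<eta> \<beta>) hpo_inl"
  unfolding pmap_def continuous_map_def topspace_hpo[OF eta beta]
  by (auto simp: openin_hpo hpo_open_def hpo_points_def)

lemma pmap_hpo_inr: "pmap B (hpo W A B \<eta> \<beta>) (hpo_inr A B)"
  unfolding pmap_def continuous_map_def topspace_hpo[OF eta beta]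
  by (auto simp: openin_hpo hpo_open_def hpo_points_def hpo_inr_base)

lemma continuous_map_hpo_htpy:
  "continuous_map (prod_topology I01 (ptop W)) (ptop (hpo W A B \<eta> \<beta>)) (hpo_htpy W A B \<eta> \<beta>)"
  unfolding continuous_map_def topspace_hpo[OF eta beta]
  by (auto simp: openin_hpo hpo_open_def hpo_points_def)

lemma phomotopy_hpo_htpy:
  "phomotopy W (hpo W A B \<eta> \<beta>) (hpo_inl \<circ> \<eta>) (hpo_inr A B \<circ> \<beta>) (hpo_htpy W A B \<eta> \<beta>)"
  unfolding phomotopy_def
  by (simp add: continuous_map_hpo_htpy hpo_htpy_simps hpo_htpy_base[OF eta beta])

lemma continuous_map_from_hpo:
  assumes a: "continuous_map (ptop A) Z (\<lambda>x. k (hpo_inl x))"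
    and b: "continuous_map (ptop B) Z (\<lambda>x. k (hpo_inr A B x))"
    and h: "continuous_map (prod_topology I01 (ptop W)) Z (\<lambda>x. k (hpo_htpy W A B \<eta> \<beta> x))"
  shows "continuous_map (ptop (hpo W A B \<eta> \<beta>)) Z k"
  unfolding continuous_map_def
proof (intro conjI allI impI)
  show "k \<in> pts (hpo W A B \<eta> \<beta>) \<rightarrow> topspace Z"
  proof
    fix z assume "z \<in> pts (hpo W A B \<eta> \<beta>)"
    then show "k z \<in> topspace Z"
      by (cases rule: hpo_point_cases)
         (use a b h in \<open>auto simp: continuous_map_def Pi_iff\<close>)
  qed
  fix U assume U: "openin Z U"
  let ?V = "{z \<in> hpo_points W A B \<eta> \<beta>. k z \<in> U}"
  have "{x \<in> pts A. hpo_inl x \<in> ?V} = {x \<in> pts A. k (hpo_inl x) \<in> U}"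
    "{x \<in> pts B. hpo_inr A B x \<in> ?V} = {x \<in> pts B. k (hpo_inr A B x) \<in> U}"
    "{z \<in> {0..1} \<times> pts W. hpo_htpy W A B \<eta> \<beta> z \<in> ?V} =
      {z \<in> topspace (prod_topology I01 (ptop W)). k (hpo_htpy W A B \<eta> \<beta> z) \<in> U}"
    by (auto simp: hpo_points_def)
  then have "hpo_open W A B \<eta> \<beta> ?V"
    using openin_continuous_map_preimage[OF a U] openin_continuous_map_preimage[OF b U]
      openin_continuous_map_preimage[OF h U]
    unfolding hpo_open_def by simp
  then show "openin (ptop (hpo W A B \<eta> \<beta>)) {z \<in> pts (hpo W A B \<eta> \<beta>). k z \<in> U}"
    by (simp add: topspace_hpo[OF eta beta] openin_hpo)
qed

text \<open>
  The product of a quotient map with the unit interval is again a quotient map.  Currying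
  reduces this to the universal property of the quotient itself: a homotopy out of the pushout is a
  map from the pushout to a path space.
\<close>

lemma continuous_map_homotopy_from_hpo:
  assumes a: "continuous_map (prod_topology I01 (ptop A)) Z (\<lambda>x. k (fst x, hpo_inl (snd x)))"
    and b: "continuous_map (prod_topology I01 (ptop B)) Z (\<lambda>x. k (fst x, hpo_inr A B (snd x)))"
    and h: "continuous_map (prod_topology I01 (prod_topology I01 (ptop W))) Z
      (\<lambda>x. k (fst x, hpo_htpy W A B \<eta> \<beta> (snd x)))"
  shows "continuous_map (prod_topology I01 (ptop (hpo W A B \<eta> \<beta>))) Z k"
proof -
  define K where "K = (\<lambda>z. \<lambda>t\<in>{0..1}. k (t, z))"
  have "continuous_map (ptop (hpo W A B \<eta> \<beta>)) (path_topology Z) K"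
    by (rule continuous_map_from_hpo; unfold K_def)
       (use continuous_map_path_curry[OF a] continuous_map_path_curry[OF b]
          continuous_map_path_curry[OF h] in simp_all)
  then have "continuous_map (prod_topology I01 (ptop (hpo W A B \<eta> \<beta>))) Z (\<lambda>x. K (snd x) (fst x))"
    using continuous_map_app2[OF continuous_map_path_evaluation continuous_map_fst
      continuous_map_app[OF _ continuous_map_snd]] by fastforce
  then show ?thesis
    by (rule continuous_map_eq) (auto simp: K_def)
qed

lemma hpo_whisker_htpy:
  assumes "a (pbase A) = b (pbase B)" "h (0, w) = a (\<eta> w)" "h (1, w) = b (\<beta> w)"
    "h (t, pbase W) = a (pbase A)"
  shows "hpo_whisker a b h (hpo_htpy W A B \<eta> \<beta> (t, w)) = h (t, w)"
  using assms by (auto simp: hpo_htpy_def hpo_whisker_inr) (simp_all add: hpo_whisker_def)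

lemma
  assumes a: "pmap A Z a" and b: "pmap B Z b" and h: "phomotopy W Z (a \<circ> \<eta>) (b \<circ> \<beta>) h"
  shows hpo_whisker_phomotopy_inr: "hpo_whisker a b h (hpo_inr A B x) = b x"
    and hpo_whisker_phomotopy_htpy: "\<And>t w. 0 \<le> t \<Longrightarrow> t \<le> 1 \<Longrightarrow> w \<in> pts W \<Longrightarrow>
      hpo_whisker a b h (hpo_htpy W A B \<eta> \<beta> (t, w)) = h (t, w)"
    and pmap_hpo_whisker: "pmap (hpo W A B \<eta> \<beta>) Z (hpo_whisker a b h)"
proof -
  have ab: "a (pbase A) = b (pbase B)" using a b by (simp add: pmap_def)
  show 1: "hpo_whisker a b h (hpo_inr A B x) = b x" for x
    by (rule hpo_whisker_inr[where a=a and b=b]) (rule ab)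
  show 2: "hpo_whisker a b h (hpo_htpy W A B \<eta> \<beta> (t, w)) = h (t, w)"
    if "0 \<le> t" "t \<le> 1" "w \<in> pts W" for t w
    by (rule hpo_whisker_htpy[of a b h]) (use ab phomotopyD[OF h] that pmapD[OF a] in auto)
  have "continuous_map (ptop (hpo W A B \<eta> \<beta>)) (ptop Z) (hpo_whisker a b h)"
  proof (rule continuous_map_from_hpo)
    show "continuous_map (prod_topology I01 (ptop W)) (ptop Z)
        (\<lambda>x. hpo_whisker a b h (hpo_htpy W A B \<eta> \<beta> x))"
      by (rule continuous_map_eq[OF phomotopyD(1)[OF h]]) (auto simp: 2)
  qed (use pmapD(1)[OF a] pmapD(1)[OF b] in \<open>simp_all add: 1\<close>)
  then show "pmap (hpo W A B \<eta> \<beta>) Z (hpo_whisker a b h)"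
    using pmapD(2)[OF a] by (simp add: pmap_def)
qed

text \<open>
  Homotopies out of a pushout are glued from homotopies on its three pieces; the common whisker map
  at each time \<open>s\<close> is continuous in \<open>s\<close> as well by the preceding lemma.
\<close>

lemma phomotopic_from_hpo:
  assumes A: "pointed_space A"
    and ha: "phomotopy A Z (\<lambda>x. f (hpo_inl x)) (\<lambda>x. g (hpo_inl x)) ha"
    and hb: "phomotopy B Z (\<lambda>x. f (hpo_inr A B x)) (\<lambda>x. g (hpo_inr A B x)) hb"
    and hw: "continuous_map (prod_topology I01 (prod_topology I01 (ptop W))) (ptop Z) hw"
    and f: "\<And>t w. 0 \<le> t \<Longrightarrow> t \<le> 1 \<Longrightarrow> w \<in> pts W \<Longrightarrow> hw (0, (t, w)) = f (hpo_htpy W A B \<eta> \<beta> (t, w))"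
    and g: "\<And>t w. 0 \<le> t \<Longrightarrow> t \<le> 1 \<Longrightarrow> w \<in> pts W \<Longrightarrow> hw (1, (t, w)) = g (hpo_htpy W A B \<eta> \<beta> (t, w))"
    and hwa: "\<And>s w. 0 \<le> s \<Longrightarrow> s \<le> 1 \<Longrightarrow> w \<in> pts W \<Longrightarrow> hw (s, (0, w)) = ha (s, \<eta> w)"
    and hwb: "\<And>s w. 0 \<le> s \<Longrightarrow> s \<le> 1 \<Longrightarrow> w \<in> pts W \<Longrightarrow> hw (s, (1, w)) = hb (s, \<beta> w)"
    and hw0: "\<And>s t. 0 \<le> s \<Longrightarrow> s \<le> 1 \<Longrightarrow> 0 \<le> t \<Longrightarrow> t \<le> 1 \<Longrightarrow> hw (s, (t, pbase W)) = pbase Z"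
  shows "phomotopic (hpo W A B \<eta> \<beta>) Z f g"
proof (rule phomotopicI[OF pointed_hpo[OF A eta beta]])
  define k where "k = (\<lambda>(s, z). hpo_whisker (\<lambda>a. ha (s, a)) (\<lambda>b. hb (s, b)) (\<lambda>x. hw (s, x)) z)"
  have kl: "k (s, hpo_inl a) = ha (s, a)" for s a
    by (simp add: k_def)
  have base: "ha (s, pbase A) = hb (s, pbase B)" if "0 \<le> s" "s \<le> 1" for s
    using phomotopyD(4)[OF ha that] phomotopyD(4)[OF hb that] by simp
  have kr: "k (s, hpo_inr A B b) = hb (s, b)" if "0 \<le> s" "s \<le> 1" for s b
    by (simp add: k_def hpo_whisker_inr base that)
  have kw: "k (s, hpo_htpy W A B \<eta> \<beta> (t, w)) = hw (s, (t, w))"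
    if "0 \<le> s" "s \<le> 1" "0 \<le> t" "t \<le> 1" "w \<in> pts W" for s t w
    unfolding k_def prod.case
    by (rule hpo_whisker_htpy) (use that in \<open>simp_all add: base hwa hwb hw0 phomotopyD(4)[OF ha] phomotopyD(4)[OF hb]\<close>)
  have c: "continuous_map (prod_topology I01 (ptop (hpo W A B \<eta> \<beta>))) (ptop Z) k"
  proof (rule continuous_map_homotopy_from_hpo)
    show "continuous_map (prod_topology I01 (ptop A)) (ptop Z) (\<lambda>x. k (fst x, hpo_inl (snd x)))"
      using phomotopyD(1)[OF ha] by (simp add: kl)
    show "continuous_map (prod_topology I01 (ptop B)) (ptop Z) (\<lambda>x. k (fst x, hpo_inr A B (snd x)))"
      by (rule continuous_map_eq[OF phomotopyD(1)[OF hb]]) (auto simp: kr)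
    show "continuous_map (prod_topology I01 (prod_topology I01 (ptop W))) (ptop Z)
        (\<lambda>x. k (fst x, hpo_htpy W A B \<eta> \<beta> (snd x)))"
      by (rule continuous_map_eq[OF hw]) (auto simp: kw)
  qed
  have "k (0, z) = f z \<and> k (1, z) = g z" if "z \<in> pts (hpo W A B \<eta> \<beta>)" for z
    using that
  proof (cases rule: hpo_point_cases)
    case (inl a) then show ?thesis using phomotopyD(2,3)[OF ha] by (simp add: kl)
  next
    case (inr b) then show ?thesis using phomotopyD(2,3)[OF hb] by (simp add: kr)
  next
    case (htpy t w) then show ?thesis by (simp add: kw f g)
  qed
  moreover have "k (t, pbase (hpo W A B \<eta> \<beta>)) = pbase Z" if "t \<in> {0..1}" for t
    using phomotopyD(4)[OF ha, of t] that by (simp add: kl)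
  ultimately show "phomotopy (hpo W A B \<eta> \<beta>) Z f g k"
    using c by (auto simp: phomotopy_def)
qed

end

text \<open>
  The standard whisker map, composed with a homotopy inverse of the comparison map, is a possible
  choice for the whisker map out of \<open>S\<close>.
\<close>

lemma hpushout_whisker_spec:
  assumes A: "pointed_space A"
    and sq: "hpushout_square W A B S \<eta> \<beta> u v H"
    and m: "pmap (hpo W A B \<eta> \<beta>) Z (hpo_whisker a b h)"
  shows "pmap S Z (hpushout_whisker W A B S \<eta> \<beta> u v H Z a b h)"
    "phomotopic (hpo W A B \<eta> \<beta>) Z
      (hpushout_whisker W A B S \<eta> \<beta> u v H Z a b h \<circ> hpo_whisker u v H) (hpo_whisker a b h)"
proof -
  have eta: "pmap W A \<eta>" and beta: "pmap W B \<beta>"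
    and eq: "phomotopy_equivalence (hpo W A B \<eta> \<beta>) S (hpo_whisker u v H)"
    using sq by (auto simp: hpushout_square_def)
  note P = pointed_hpo[OF A eta beta]
  obtain q where q: "pmap S (hpo W A B \<eta> \<beta>) q"
    "phomotopic (hpo W A B \<eta> \<beta>) (hpo W A B \<eta> \<beta>) (q \<circ> hpo_whisker u v H) id"
    using eq by (auto simp: phomotopy_equivalence_def)
  have "pmap S Z (hpo_whisker a b h \<circ> q)" by (rule pmap_comp[OF q(1) m])
  moreover have "phomotopic (hpo W A B \<eta> \<beta>) Z ((hpo_whisker a b h \<circ> q) \<circ> hpo_whisker u v H) (hpo_whisker a b h)"
    using phomotopic_postcomp[OF P q(2) m] by (simp add: comp_assoc)
  ultimately have "\<exists>\<omega>. pmap S Z \<omega> \<and> phomotopic (hpo W A B \<eta> \<beta>) Z (\<omega> \<circ> hpo_whisker u v H) (hpo_whisker a b h)"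
    by blast
  from someI_ex[OF this]
  show "pmap S Z (hpushout_whisker W A B S \<eta> \<beta> u v H Z a b h)"
    "phomotopic (hpo W A B \<eta> \<beta>) Z
      (hpushout_whisker W A B S \<eta> \<beta> u v H Z a b h \<circ> hpo_whisker u v H) (hpo_whisker a b h)"
    unfolding hpushout_whisker_def by blast+
qed

section \<open>Maps into a fibrewise join\<close>

text \<open>
  The map from a standard homotopy pushout to a fibrewise join that a square \<open>Q\<close> over \<open>X\<close> induces, by the
  universal properties of the homotopy pullback and of the pushout.
\<close>

definition square_map ::
  "('a \<Rightarrow> 'j) \<Rightarrow> ('g \<Rightarrow> 'j) \<Rightarrow> (real \<times> ('a \<times> (real \<Rightarrow> 'x) \<times> 'g) \<Rightarrow> 'j) \<Rightarrow>
     ('w \<Rightarrow> 'a) \<Rightarrow> ('w \<Rightarrow> 'b) \<Rightarrow> ('b \<Rightarrow> 'g) \<Rightarrow> (real \<times> 'w \<Rightarrow> 'x) \<Rightarrow> ('w, 'a, 'b) dcyl \<Rightarrow> 'j" where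
  "square_map l r c \<eta> \<beta> k Q =
     hpo_whisker l (r \<circ> k) (\<lambda>(t, w). c (t, hpb_whisker \<eta> (k \<circ> \<beta>) Q w))"

text \<open>
  What maps into a fibrewise join \<open>J\<close> of \<open>A\<close> and \<open>G\<close> over \<open>X\<close> are built from: the inclusions, the join
  lines \<open>c\<close>, and the projection \<open>e\<close>, which runs along the path \<open>p\<close> on the line of \<open>(a, p, b)\<close>.  In this
  form the structure passes to relabelled copies of the standard pushout, which is what the spaces of
  the Ganea construction are.
\<close>

locale fibre_join =
  fixes A :: "'a pspace" and G :: "'g pspace" and X :: "'x pspace"
    and \<iota> g and J :: "'j pspace" and l r c e
  assumes A: "pointed_space A" and G: "pointed_space G" and X: "pointed_space X"
    and J: "pointed_space J"
    and iota: "pmap A X \<iota>" and g: "pmap G X g" and l: "pmap A J l" and r: "pmap G J r"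
    and c: "phomotopy (hpb A G X \<iota> g) J (l \<circ> hpb_fst) (r \<circ> hpb_snd) c"
    and e: "pmap J X e"
    and e_l: "\<And>a. a \<in> pts A \<Longrightarrow> e (l a) = \<iota> a"
    and e_r: "\<And>b. b \<in> pts G \<Longrightarrow> e (r b) = g b"
    and e_c: "\<And>t z. 0 \<le> t \<Longrightarrow> t \<le> 1 \<Longrightarrow> z \<in> pts (hpb A G X \<iota> g) \<Longrightarrow> e (c (t, z)) = fst (snd z) t"
begin

lemma continuous_map_join_line:
  assumes t: "continuous_map Z I01 t"
    and a: "continuous_map Z (ptop A) a" and b: "continuous_map Z (ptop G) b"
    and h: "continuous_map (prod_topology I01 Z) (ptop X) h"
    and "\<And>z. z \<in> topspace Z \<Longrightarrow> h (0, z) = \<iota> (a z)" "\<And>z. z \<in> topspace Z \<Longrightarrow> h (1, z) = g (b z)"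
  shows "continuous_map Z (ptop J) (\<lambda>z. c (t z, hpb_whisker a b h z))"
  by (rule continuous_map_app2[OF phomotopyD(1)[OF c] t]) (rule continuous_map_hpb_whisker; fact)

lemma line_ends:
  assumes "a \<in> pts A" "b \<in> pts G" "continuous_map I01 (ptop X) p" "p 0 = \<iota> a" "p 1 = g b"
  shows "c (0, (a, (\<lambda>t\<in>{0..1}. p t), b)) = l a" "c (1, (a, (\<lambda>t\<in>{0..1}. p t), b)) = r b"
    "0 \<le> t \<Longrightarrow> t \<le> 1 \<Longrightarrow> e (c (t, (a, (\<lambda>t\<in>{0..1}. p t), b))) = p t"
proof -
  have "continuous_map I01 (ptop X) (\<lambda>t\<in>{0..1}. p t)"
    by (rule continuous_map_eq[OF assms(3)]) auto
  then have "(a, (\<lambda>t\<in>{0..1}. p t), b) \<in> pts (hpb A G X \<iota> g)"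
    using assms by (auto simp: topspace_hpb path_set_def pathin_def)
  then show "c (0, (a, (\<lambda>t\<in>{0..1}. p t), b)) = l a" "c (1, (a, (\<lambda>t\<in>{0..1}. p t), b)) = r b"
    "0 \<le> t \<Longrightarrow> t \<le> 1 \<Longrightarrow> e (c (t, (a, (\<lambda>t\<in>{0..1}. p t), b))) = p t"
    using phomotopyD(2,3)[OF c] e_c by auto
qed

lemma whisker_line_ends:
  assumes "a z \<in> pts A" "b z \<in> pts G" "z \<in> topspace Z"
    "continuous_map (prod_topology I01 Z) (ptop X) h" "h (0, z) = \<iota> (a z)" "h (1, z) = g (b z)"
  shows "c (0, hpb_whisker a b h z) = l (a z)" "c (1, hpb_whisker a b h z) = r (b z)"
    "0 \<le> t \<Longrightarrow> t \<le> 1 \<Longrightarrow> e (c (t, hpb_whisker a b h z)) = h (t, z)"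
proof -
  have "continuous_map I01 (ptop X) (\<lambda>t. h (t, z))"
    by (rule continuous_map_app2[OF assms(4)]) (use assms(3) in auto)
  from line_ends[OF assms(1,2) this assms(5,6)]
  show "c (0, hpb_whisker a b h z) = l (a z)" "c (1, hpb_whisker a b h z) = r (b z)"
    "0 \<le> t \<Longrightarrow> t \<le> 1 \<Longrightarrow> e (c (t, hpb_whisker a b h z)) = h (t, z)"
    by (auto simp: hpb_whisker_def)
qed

lemma line_base:
  assumes "0 \<le> t" "t \<le> 1"
    and "a z = pbase A" "b z = pbase G" "\<And>u. 0 \<le> u \<Longrightarrow> u \<le> 1 \<Longrightarrow> h (u, z) = pbase X"
  shows "c (t, hpb_whisker a b h z) = pbase J"
  using hpb_whisker_base[of a z A b G h X \<iota> g] phomotopyD(4)[OF c assms(1,2)] assms(3-) by simp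

context
  fixes W :: "'w pspace" and B :: "'b pspace" and \<eta> \<beta>
  assumes W: "pointed_space W" and B: "pointed_space B"
    and eta: "pmap W A \<eta>" and beta: "pmap W B \<beta>"
begin

context
  fixes k Q
  assumes k: "pmap B G k" and Q: "phomotopy W X (\<iota> \<circ> \<eta>) (g \<circ> k \<circ> \<beta>) Q"
begin

lemma phomotopy_square_map:
  "phomotopy W J (l \<circ> \<eta>) (r \<circ> k \<circ> \<beta>) (\<lambda>(t, w). c (t, hpb_whisker \<eta> (k \<circ> \<beta>) Q w))"
proof -
  have bk: "pmap W G (k \<circ> \<beta>)" using beta k by (rule pmap_comp)
  have W': "continuous_map (ptop W) (ptop (hpb A G X \<iota> g)) (hpb_whisker \<eta> (k \<circ> \<beta>) Q)"
    by (rule continuous_map_hpb_whisker)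
       (use pmapD[OF eta] pmapD[OF bk] phomotopyD[OF Q] in auto)
  have "continuous_map (prod_topology I01 (ptop W)) (ptop J)
      (\<lambda>z. c (fst z, hpb_whisker \<eta> (k \<circ> \<beta>) Q (snd z)))"
    by (rule continuous_map_app2[OF phomotopyD(1)[OF c] continuous_map_fst
      continuous_map_app[OF W' continuous_map_snd]])
  moreover have "c (0, hpb_whisker \<eta> (k \<circ> \<beta>) Q w) = l (\<eta> w)"
    "c (1, hpb_whisker \<eta> (k \<circ> \<beta>) Q w) = r (k (\<beta> w))" if "w \<in> pts W" for w
    using whisker_line_ends[of \<eta> w "k \<circ> \<beta>" "ptop W" Q] that pmapD[OF eta] pmapD[OF bk]
      phomotopyD[OF Q] by auto
  moreover have "c (t, hpb_whisker \<eta> (k \<circ> \<beta>) Q (pbase W)) = pbase J" if "0 \<le> t" "t \<le> 1" for t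
    by (rule line_base[OF that]) (use pmapD[OF eta] pmapD[OF bk] phomotopyD[OF Q] in auto)
  ultimately show ?thesis
    by (auto simp: phomotopy_def case_prod_unfold)
qed

lemma square_map_inl: "square_map l r c \<eta> \<beta> k Q (hpo_inl a) = l a"
  by (simp add: square_map_def hpo_whisker_def hpo_inl_def)

lemma square_map_inr: "square_map l r c \<eta> \<beta> k Q (hpo_inr A B b) = r (k b)"
  unfolding square_map_def
  using hpo_whisker_phomotopy_inr[OF eta beta l pmap_comp[OF k r] phomotopy_square_map] by simp

lemma square_map_htpy:
  "0 \<le> t \<Longrightarrow> t \<le> 1 \<Longrightarrow> w \<in> pts W \<Longrightarrow>
    square_map l r c \<eta> \<beta> k Q (hpo_htpy W A B \<eta> \<beta> (t, w)) = c (t, hpb_whisker \<eta> (k \<circ> \<beta>) Q w)"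
  unfolding square_map_def
  using hpo_whisker_phomotopy_htpy[OF eta beta l pmap_comp[OF k r] phomotopy_square_map] by simp

lemma pmap_square_map: "pmap (hpo W A B \<eta> \<beta>) J (square_map l r c \<eta> \<beta> k Q)"
  unfolding square_map_def
  by (rule pmap_hpo_whisker[OF eta beta l pmap_comp[OF k r] phomotopy_square_map])

lemma e_square_map:
  "a \<in> pts A \<Longrightarrow> e (square_map l r c \<eta> \<beta> k Q (hpo_inl a)) = \<iota> a"
  "b \<in> pts B \<Longrightarrow> e (square_map l r c \<eta> \<beta> k Q (hpo_inr A B b)) = g (k b)"
  "0 \<le> t \<Longrightarrow> t \<le> 1 \<Longrightarrow> w \<in> pts W \<Longrightarrow>
    e (square_map l r c \<eta> \<beta> k Q (hpo_htpy W A B \<eta> \<beta> (t, w))) = Q (t, w)"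
proof -
  have bk: "pmap W G (k \<circ> \<beta>)" using beta k by (rule pmap_comp)
  show "a \<in> pts A \<Longrightarrow> e (square_map l r c \<eta> \<beta> k Q (hpo_inl a)) = \<iota> a"
    by (simp add: square_map_inl e_l)
  show "b \<in> pts B \<Longrightarrow> e (square_map l r c \<eta> \<beta> k Q (hpo_inr A B b)) = g (k b)"
    using pmapD(3)[OF k] by (simp add: square_map_inr e_r)
  show "0 \<le> t \<Longrightarrow> t \<le> 1 \<Longrightarrow> w \<in> pts W \<Longrightarrow>
    e (square_map l r c \<eta> \<beta> k Q (hpo_htpy W A B \<eta> \<beta> (t, w))) = Q (t, w)"
    using whisker_line_ends(3)[of \<eta> w "k \<circ> \<beta>" "ptop W" Q] pmapD[OF eta] pmapD[OF bk]
      phomotopyD[OF Q] by (auto simp: square_map_htpy)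
qed

end

text \<open>
  Deforming \<open>k\<close> and \<open>Q\<close> simultaneously moves each join line through join lines.
\<close>

lemma square_map_phomotopic:
  assumes k: "phomotopy B G k0 k1 k"
    and Q: "continuous_map (prod_topology I01 (prod_topology I01 (ptop W))) (ptop X) Q"
    and Ql: "\<And>s w. 0 \<le> s \<Longrightarrow> s \<le> 1 \<Longrightarrow> w \<in> pts W \<Longrightarrow> Q (s, (0, w)) = \<iota> (\<eta> w)"
    and Qr: "\<And>s w. 0 \<le> s \<Longrightarrow> s \<le> 1 \<Longrightarrow> w \<in> pts W \<Longrightarrow> Q (s, (1, w)) = g (k (s, \<beta> w))"
    and Qb: "\<And>s u. 0 \<le> s \<Longrightarrow> s \<le> 1 \<Longrightarrow> 0 \<le> u \<Longrightarrow> u \<le> 1 \<Longrightarrow> Q (s, (u, pbase W)) = pbase X"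
    and Q0: "\<And>u w. 0 \<le> u \<Longrightarrow> u \<le> 1 \<Longrightarrow> w \<in> pts W \<Longrightarrow> Q (0, (u, w)) = Q0 (u, w)"
    and Q1: "\<And>u w. 0 \<le> u \<Longrightarrow> u \<le> 1 \<Longrightarrow> w \<in> pts W \<Longrightarrow> Q (1, (u, w)) = Q1 (u, w)"
  shows "phomotopic (hpo W A B \<eta> \<beta>) J (square_map l r c \<eta> \<beta> k0 Q0) (square_map l r c \<eta> \<beta> k1 Q1)"
proof -
  have bW: "pbase W \<in> pts W" using W by (simp add: pointed_space_def)
  have ends: "phomotopy W X (\<iota> \<circ> \<eta>) (g \<circ> k' \<circ> \<beta>) Q'"
    if s: "0 \<le> s" "s \<le> 1" and k': "\<And>b. b \<in> pts B \<Longrightarrow> k (s, b) = k' b"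
      and Q': "\<And>u w. 0 \<le> u \<Longrightarrow> u \<le> 1 \<Longrightarrow> w \<in> pts W \<Longrightarrow> Q (s, (u, w)) = Q' (u, w)" for s k' Q'
  proof -
    have "continuous_map (prod_topology I01 (ptop W)) (ptop X) (\<lambda>z. Q (s, z))"
      by (rule continuous_map_app2[OF Q]) (use s in auto)
    then have "continuous_map (prod_topology I01 (ptop W)) (ptop X) Q'"
      by (rule continuous_map_eq) (auto simp: Q')
    then show ?thesis
      using Ql[OF s] Qr[OF s] Qb[OF s] pmapD(3)[OF beta] bW
      by (auto simp: phomotopy_def k' simp flip: Q')
  qed
  note k01 = phomotopy_ends[OF k B]
  have S0: "phomotopy W X (\<iota> \<circ> \<eta>) (g \<circ> k0 \<circ> \<beta>) Q0"
    by (rule ends[of 0]) (use phomotopyD[OF k] Q0 in auto)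
  have S1: "phomotopy W X (\<iota> \<circ> \<eta>) (g \<circ> k1 \<circ> \<beta>) Q1"
    by (rule ends[of 1]) (use phomotopyD[OF k] Q1 in auto)
  let ?Z = "prod_topology I01 (prod_topology I01 (ptop W))"
  let ?a = "\<lambda>z::real \<times> real \<times> 'w. \<eta> (snd (snd z))"
  let ?b = "\<lambda>z::real \<times> real \<times> 'w. k (fst z, \<beta> (snd (snd z)))"
  let ?h = "\<lambda>(u, z::real \<times> real \<times> 'w). Q (fst z, (u, snd (snd z)))"
  have ca: "continuous_map ?Z (ptop A) ?a"
    by (rule continuous_map_app[OF pmapD(1)[OF eta] continuous_map_triple_projections(2)])
  have cb: "continuous_map ?Z (ptop G) ?b"
    by (rule continuous_map_app2[OF phomotopyD(1)[OF k] continuous_map_fst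
      continuous_map_app[OF pmapD(1)[OF beta] continuous_map_triple_projections(2)]])
  have ch: "continuous_map (prod_topology I01 ?Z) (ptop X) ?h"
    unfolding case_prod_unfold
    by (intro continuous_map_app2[OF Q] continuous_map_pairedI continuous_map_fst
      continuous_map_app[OF continuous_map_fst continuous_map_snd]
      continuous_map_app[OF continuous_map_triple_projections(2) continuous_map_snd])
  show ?thesis
  proof (rule phomotopic_from_hpo[OF eta beta A, where ha = "\<lambda>(s, a). l a" and hb = "\<lambda>(s, b). r (k (s, b))"
        and hw = "\<lambda>z. c (fst (snd z), hpb_whisker ?a ?b ?h z)"])
    show "phomotopy A J (\<lambda>x. square_map l r c \<eta> \<beta> k0 Q0 (hpo_inl x))
        (\<lambda>x. square_map l r c \<eta> \<beta> k1 Q1 (hpo_inl x)) (\<lambda>(s, a). l a)"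
      using pmapD[OF l] continuous_map_app[OF pmapD(1)[OF l] continuous_map_snd[of I01 "ptop A"]]
      by (simp add: phomotopy_def case_prod_unfold square_map_inl[OF k01(1) S0] square_map_inl[OF k01(2) S1])
    have "continuous_map (prod_topology I01 (ptop B)) (ptop J) (\<lambda>z. r (k z))"
      by (rule continuous_map_app[OF pmapD(1)[OF r] phomotopyD(1)[OF k]])
    then show "phomotopy B J (\<lambda>x. square_map l r c \<eta> \<beta> k0 Q0 (hpo_inr A B x))
        (\<lambda>x. square_map l r c \<eta> \<beta> k1 Q1 (hpo_inr A B x)) (\<lambda>(s, b). r (k (s, b)))"
      using phomotopyD[OF k] pmapD[OF r]
      by (simp add: phomotopy_def case_prod_unfold square_map_inr[OF k01(1) S0] square_map_inr[OF k01(2) S1])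
    show "continuous_map ?Z (ptop J) (\<lambda>z. c (fst (snd z), hpb_whisker ?a ?b ?h z))"
      by (rule continuous_map_join_line[OF continuous_map_triple_projections(1) ca cb ch])
         (auto simp: Ql Qr)
    fix s t :: real and w assume st: "0 \<le> s" "s \<le> 1" and w: "w \<in> pts W"
    have wl: "c (0, hpb_whisker ?a ?b ?h z) = l (?a z)" "c (1, hpb_whisker ?a ?b ?h z) = r (?b z)"
      if "z \<in> topspace ?Z" for z
      by (rule whisker_line_ends[of ?a z ?b ?Z ?h];
          use that ca cb ch in \<open>auto simp: continuous_map_def Pi_iff Ql Qr\<close>)+
    show "c (fst (snd (s, 0, w)), hpb_whisker ?a ?b ?h (s, 0, w)) = (\<lambda>(s, a). l a) (s, \<eta> w)"
      using wl(1)[of "(s, 0, w)"] st w by simp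
    show "c (fst (snd (s, 1, w)), hpb_whisker ?a ?b ?h (s, 1, w)) = (\<lambda>(s, b). r (k (s, b))) (s, \<beta> w)"
      using wl(2)[of "(s, 1, w)"] st w by simp
  next
    fix t :: real and w assume t: "0 \<le> t" "t \<le> 1" and w: "w \<in> pts W"
    have "hpb_whisker ?a ?b ?h (0, t, w) = hpb_whisker \<eta> (k0 \<circ> \<beta>) Q0 w"
      by (rule hpb_whisker_eqI) (use w pmapD(3)[OF beta] in \<open>auto simp: phomotopyD(2)[OF k] Q0\<close>)
    then show "c (fst (snd (0, t, w)), hpb_whisker ?a ?b ?h (0, t, w)) =
        square_map l r c \<eta> \<beta> k0 Q0 (hpo_htpy W A B \<eta> \<beta> (t, w))"
      by (simp add: square_map_htpy[OF k01(1) S0 t w])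
    have "hpb_whisker ?a ?b ?h (1, t, w) = hpb_whisker \<eta> (k1 \<circ> \<beta>) Q1 w"
      by (rule hpb_whisker_eqI) (use w pmapD(3)[OF beta] in \<open>auto simp: phomotopyD(3)[OF k] Q1\<close>)
    then show "c (fst (snd (1, t, w)), hpb_whisker ?a ?b ?h (1, t, w)) =
        square_map l r c \<eta> \<beta> k1 Q1 (hpo_htpy W A B \<eta> \<beta> (t, w))"
      by (simp add: square_map_htpy[OF k01(2) S1 t w])
  next
    fix s t :: real assume st: "0 \<le> s" "s \<le> 1" "0 \<le> t" "t \<le> 1"
    show "c (fst (snd (s, t, pbase W)), hpb_whisker ?a ?b ?h (s, t, pbase W)) = pbase J"
      unfolding fst_conv snd_conv
      by (rule line_base) (use st in \<open>auto simp: pmapD(2)[OF eta] pmapD(2)[OF beta] phomotopyD(4)[OF k] Qb\<close>)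
  qed
qed

text \<open>
  Pushing a map \<open>\<phi>\<close> along the join lines.  The point of \<open>J\<close> with parameters \<open>(s', t')\<close> over
  \<open>w\<close> is the point at time \<open>t'\<close> on the line from \<open>\<eta> w\<close> to the image under \<open>\<phi>\<close> of the point \<open>(s', w)\<close>
  of the cylinder, along the path \<open>M(s', -, w)\<close>.  At \<open>t' = 1\<close> this is \<open>r \<circ> \<phi>\<close> at \<open>(s', w)\<close>, while at \<open>s' = 1\<close> it
  is the square map at \<open>(t', w)\<close>.  The homotopy moves the edge \<open>t' = 1\<close> of the parameter square, run through
  by \<open>s'\<close>, to the edge \<open>s' = 1\<close>, run through by \<open>t'\<close>, keeping the corner \<open>(1, 1)\<close> fixed.  The
  starting point moves from \<open>(0, 1)\<close> to \<open>(0, 0)\<close> and then along \<open>t' = 0\<close>; on both segments the point of \<open>J\<close>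
  depends on \<open>\<eta> w\<close> only, so that the homotopy is defined on the copy of \<open>A\<close>.
\<close>

lemma inr_phomotopic_square_map:
  assumes \<phi>: "pmap (hpo W A B \<eta> \<beta>) G \<phi>"
    and m: "phomotopy A X \<iota> (\<lambda>a. g (\<phi> (hpo_inl a))) m"
    and M: "continuous_map (prod_topology I01 (prod_topology I01 (ptop W))) (ptop X) M"
    and Ml: "\<And>s w. 0 \<le> s \<Longrightarrow> s \<le> 1 \<Longrightarrow> w \<in> pts W \<Longrightarrow> M (s, (0, w)) = \<iota> (\<eta> w)"
    and Mr: "\<And>s w. 0 \<le> s \<Longrightarrow> s \<le> 1 \<Longrightarrow> w \<in> pts W \<Longrightarrow>
      M (s, (1, w)) = g (\<phi> (hpo_htpy W A B \<eta> \<beta> (s, w)))"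
    and Mb: "\<And>s u. 0 \<le> s \<Longrightarrow> s \<le> 1 \<Longrightarrow> 0 \<le> u \<Longrightarrow> u \<le> 1 \<Longrightarrow> M (s, (u, pbase W)) = pbase X"
    and M0: "\<And>u w. 0 \<le> u \<Longrightarrow> u \<le> 1 \<Longrightarrow> w \<in> pts W \<Longrightarrow> M (0, (u, w)) = m (u, \<eta> w)"
    and M1: "\<And>u w. 0 \<le> u \<Longrightarrow> u \<le> 1 \<Longrightarrow> w \<in> pts W \<Longrightarrow> M (1, (u, w)) = Q (u, w)"
  shows "phomotopic (hpo W A B \<eta> \<beta>) J (r \<circ> \<phi>) (square_map l r c \<eta> \<beta> (\<phi> \<circ> hpo_inr A B) Q)"
proof -
  have bW: "pbase W \<in> pts W" using W by (simp add: pointed_space_def)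
  note pinl = pmap_hpo_inl[OF eta beta] and pinr = pmap_hpo_inr[OF eta beta]
    and chtpy = continuous_map_hpo_htpy[OF eta beta]
  have k: "pmap B G (\<phi> \<circ> hpo_inr A B)" by (rule pmap_comp[OF pinr \<phi>])
  have "continuous_map (prod_topology I01 (ptop W)) (ptop X) (\<lambda>z. M (1, z))"
    by (rule continuous_map_app2[OF M]) auto
  then have "continuous_map (prod_topology I01 (ptop W)) (ptop X) Q"
    by (rule continuous_map_eq) (auto simp: M1)
  then have Q: "phomotopy W X (\<iota> \<circ> \<eta>) (g \<circ> (\<phi> \<circ> hpo_inr A B) \<circ> \<beta>) Q"
    using Ml[of 1] Mr[of 1] Mb[of 1] bW
    by (auto simp: phomotopy_def hpo_htpy_simps simp flip: M1)
  \<comment> \<open>the parameters \<open>s'\<close> and \<open>t'\<close> at \<open>(r, (t, w))\<close>, where \<open>r\<close> is the time of the homotopy: from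
    \<open>(t, 1)\<close> through \<open>(t, t)\<close> to \<open>(1, t)\<close>\<close>
  define S :: "real \<times> real \<times> 'w \<Rightarrow> real" where "S z = fst (snd z) + max 0 (2 * fst z - 1) * (1 - fst (snd z))" for z
  define T :: "real \<times> real \<times> 'w \<Rightarrow> real" where "T z = fst (snd z) + max 0 (1 - 2 * fst z) * (1 - fst (snd z))" for z
  let ?Z = "prod_topology I01 (prod_topology I01 (ptop W))"
  have param: "x + y * (1 - x) \<in> {0..1}" if "0 \<le> x" "x \<le> 1" "0 \<le> y" "y \<le> 1" for x y :: real
  proof -
    have "x + y * (1 - x) = 1 - (1 - x) * (1 - y)" by (simp add: algebra_simps)
    moreover have "0 \<le> (1 - x) * (1 - y)" "(1 - x) * (1 - y) \<le> 1"
      using that by (auto intro: mult_le_one)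
    ultimately show ?thesis by simp
  qed
  have fr: "continuous_map ?Z euclideanreal fst" "continuous_map ?Z euclideanreal (\<lambda>z. fst (snd z))"
    by (rule continuous_map_into_fulltopology[OF continuous_map_fst],
        rule continuous_map_into_fulltopology[OF continuous_map_triple_projections(1)])
  have cS: "continuous_map ?Z I01 S" and cT: "continuous_map ?Z I01 T"
    unfolding continuous_map_into_I01 S_def T_def
    by (intro conjI ballI param; auto intro!: continuous_intros fr)+
  have ST: "0 \<le> S z" "S z \<le> 1" "0 \<le> T z" "T z \<le> 1" if "z \<in> topspace ?Z" for z
    using cS cT that unfolding continuous_map_into_I01 by auto
  let ?a = "\<lambda>z::real \<times> real \<times> 'w. \<eta> (snd (snd z))"
  let ?b = "\<lambda>z::real \<times> real \<times> 'w. \<phi> (hpo_htpy W A B \<eta> \<beta> (S z, snd (snd z)))"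
  let ?h = "\<lambda>(u, z::real \<times> real \<times> 'w). M (S z, (u, snd (snd z)))"
  have ca: "continuous_map ?Z (ptop A) ?a"
    by (rule continuous_map_app[OF pmapD(1)[OF eta] continuous_map_triple_projections(2)])
  have cb: "continuous_map ?Z (ptop G) ?b"
    by (rule continuous_map_app[OF pmapD(1)[OF \<phi>]
      continuous_map_app2[OF chtpy cS continuous_map_triple_projections(2)]])
  have ch: "continuous_map (prod_topology I01 ?Z) (ptop X) ?h"
    unfolding case_prod_unfold
    by (intro continuous_map_app2[OF M] continuous_map_pairedI continuous_map_fst
      continuous_map_app[OF cS continuous_map_snd]
      continuous_map_app[OF continuous_map_triple_projections(2) continuous_map_snd])
  have ends: "?a z \<in> pts A" "?b z \<in> pts G" "?h (0, z) = \<iota> (?a z)" "?h (1, z) = g (?b z)"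
    if "z \<in> topspace ?Z" for z
    using that ca cb ST[OF that] by (auto simp: continuous_map_def Pi_iff Ml Mr)
  note wl = whisker_line_ends[of ?a _ ?b ?Z ?h, OF ends(1,2) _ ch ends(3,4)]
  let ?a' = "\<lambda>z::real \<times> 'a. snd z"
  let ?b' = "\<lambda>z::real \<times> 'a. \<phi> (hpo_inl (snd z))"
  let ?h' = "\<lambda>(u, z::real \<times> 'a). m (u, snd z)"
  let ?t' = "\<lambda>z::real \<times> 'a. max 0 (1 - 2 * fst z)"
  let ?Z' = "prod_topology I01 (ptop A)"
  have ft': "continuous_map ?Z' euclideanreal fst"
    by (rule continuous_map_into_fulltopology[OF continuous_map_fst])
  have ct': "continuous_map ?Z' I01 ?t'"
    unfolding continuous_map_into_I01 by (auto intro!: continuous_intros ft')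
  have cb': "continuous_map ?Z' (ptop G) ?b'"
    by (rule continuous_map_app[OF pmapD(1)[OF \<phi>] continuous_map_app[OF pmapD(1)[OF pinl] continuous_map_snd]])
  have ch': "continuous_map (prod_topology I01 ?Z') (ptop X) ?h'"
    unfolding case_prod_unfold
    by (intro continuous_map_app2[OF phomotopyD(1)[OF m]] continuous_map_fst
      continuous_map_triple_projections(2))
  have ends': "?a' z \<in> pts A" "?b' z \<in> pts G" "?h' (0, z) = \<iota> (?a' z)" "?h' (1, z) = g (?b' z)"
    if "z \<in> topspace ?Z'" for z
    using that cb' phomotopyD(2,3)[OF m] by (auto simp: continuous_map_def Pi_iff)
  note wl' = whisker_line_ends[of ?a' _ ?b' ?Z' ?h', OF ends'(1,2) _ ch' ends'(3,4)]
  have base\<phi>: "\<phi> (hpo_inl (pbase A)) = pbase G" using pmapD(2)[OF \<phi>] by simp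
  show ?thesis
  proof (rule phomotopic_from_hpo[OF eta beta A, where ha = "\<lambda>z. c (?t' z, hpb_whisker ?a' ?b' ?h' z)"
        and hb = "\<lambda>z. r (\<phi> (hpo_inr A B (snd z)))"
        and hw = "\<lambda>z. c (T z, hpb_whisker ?a ?b ?h z)"])
    show "phomotopy A J (\<lambda>x. (r \<circ> \<phi>) (hpo_inl x))
        (\<lambda>x. square_map l r c \<eta> \<beta> (\<phi> \<circ> hpo_inr A B) Q (hpo_inl x))
        (\<lambda>z. c (?t' z, hpb_whisker ?a' ?b' ?h' z))"
      unfolding phomotopy_def
    proof (intro conjI ballI)
      show "continuous_map ?Z' (ptop J) (\<lambda>z. c (?t' z, hpb_whisker ?a' ?b' ?h' z))"
        by (rule continuous_map_join_line[OF ct' continuous_map_snd cb' ch' ends'(3,4)])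
      fix x assume x: "x \<in> pts A"
      show "c (?t' (0, x), hpb_whisker ?a' ?b' ?h' (0, x)) = (r \<circ> \<phi>) (hpo_inl x)"
        using wl'(2)[of "(0, x)"] x by simp
      show "c (?t' (1, x), hpb_whisker ?a' ?b' ?h' (1, x)) =
          square_map l r c \<eta> \<beta> (\<phi> \<circ> hpo_inr A B) Q (hpo_inl x)"
        using wl'(1)[of "(1, x)"] x by (simp add: square_map_inl[OF k Q])
    next
      fix t :: real assume t: "t \<in> {0..1}"
      show "c (?t' (t, pbase A), hpb_whisker ?a' ?b' ?h' (t, pbase A)) = pbase J"
        by (rule line_base) (use t phomotopyD(4)[OF m] base\<phi> in auto)
    qed
    have "continuous_map (prod_topology I01 (ptop B)) (ptop J) (\<lambda>z. r (\<phi> (hpo_inr A B (snd z))))"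
      by (rule continuous_map_app[OF pmapD(1)[OF r] continuous_map_app[OF pmapD(1)[OF \<phi>]
        continuous_map_app[OF pmapD(1)[OF pinr] continuous_map_snd]]])
    then show "phomotopy B J (\<lambda>x. (r \<circ> \<phi>) (hpo_inr A B x))
        (\<lambda>x. square_map l r c \<eta> \<beta> (\<phi> \<circ> hpo_inr A B) Q (hpo_inr A B x)) (\<lambda>z. r (\<phi> (hpo_inr A B (snd z))))"
      using pmapD(2)[OF r] base\<phi> by (simp add: phomotopy_def square_map_inr[OF k Q] hpo_inr_base)
    show "continuous_map ?Z (ptop J) (\<lambda>z. c (T z, hpb_whisker ?a ?b ?h z))"
      by (rule continuous_map_join_line[OF cT ca cb ch ends(3,4)])
    fix t w assume t: "0 \<le> t" "t \<le> (1::real)" and w: "w \<in> pts W"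
    show "c (T (0, t, w), hpb_whisker ?a ?b ?h (0, t, w)) = (r \<circ> \<phi>) (hpo_htpy W A B \<eta> \<beta> (t, w))"
      using wl(2)[of "(0, t, w)"] t w by (simp add: T_def S_def)
    have "hpb_whisker ?a ?b ?h (1, t, w) = hpb_whisker \<eta> ((\<phi> \<circ> hpo_inr A B) \<circ> \<beta>) Q w"
      by (rule hpb_whisker_eqI) (use w in \<open>auto simp: M1 S_def hpo_htpy_simps\<close>)
    then show "c (T (1, t, w), hpb_whisker ?a ?b ?h (1, t, w)) =
        square_map l r c \<eta> \<beta> (\<phi> \<circ> hpo_inr A B) Q (hpo_htpy W A B \<eta> \<beta> (t, w))"
      by (simp add: square_map_htpy[OF k Q t w] T_def)
  next
    fix s w assume s: "0 \<le> s" "s \<le> (1::real)" and w: "w \<in> pts W"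
    show "c (T (s, 0, w), hpb_whisker ?a ?b ?h (s, 0, w)) =
        c (?t' (s, \<eta> w), hpb_whisker ?a' ?b' ?h' (s, \<eta> w))"
    proof (cases "s \<le> 1/2")
      case True
      have "hpb_whisker ?a ?b ?h (s, 0, w) = hpb_whisker ?a' ?b' ?h' (s, \<eta> w)"
        by (rule hpb_whisker_eqI) (use w True in \<open>auto simp: M0 S_def hpo_htpy_simps\<close>)
      then show ?thesis by (simp add: T_def)
    next
      case False
      then show ?thesis using wl(1)[of "(s, 0, w)"] wl'(1)[of "(s, \<eta> w)"] s w pmapD(3)[OF eta w]
        by (simp add: T_def)
    qed
    show "c (T (s, 1, w), hpb_whisker ?a ?b ?h (s, 1, w)) = r (\<phi> (hpo_inr A B (snd (s, \<beta> w))))"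
      using wl(2)[of "(s, 1, w)"] s w by (simp add: T_def S_def hpo_htpy_simps)
  next
    fix s t :: real assume st: "0 \<le> s" "s \<le> 1" "0 \<le> t" "t \<le> 1"
    have "(s, t, pbase W) \<in> topspace ?Z" using st bW by simp
    note ST' = ST[OF this]
    show "c (T (s, t, pbase W), hpb_whisker ?a ?b ?h (s, t, pbase W)) = pbase J"
      by (rule line_base)
         (use ST' in \<open>auto simp: pmapD(2)[OF eta] hpo_htpy_base[OF eta beta] base\<phi> Mb\<close>)
  qed
qed

end

end

context fibre_join
begin

context
  fixes J' :: "'k pspace" and l' r' c' e' and W :: "'w pspace" and B :: "'b pspace" and \<eta> \<beta> j k
  assumes J2: "fibre_join A J X \<iota> e J' l' r' c' e'"
    and W: "pointed_space W" and B: "pointed_space B"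
    and eta: "pmap W A \<eta>" and beta: "pmap W B \<beta>"
    and j: "pmap B A j" and k: "pmap B G k"
begin

interpretation J2: fibre_join A J X \<iota> e J' l' r' c' e' by (rule J2)

text \<open>
  In a second join, of \<open>A\<close> with the join \<open>J\<close>, the maps \<open>l \<circ> j\<close> and \<open>r \<circ> k\<close> into \<open>J\<close> are
  interchangeable: the line of \<open>J\<close> from \<open>j b\<close> to \<open>k b\<close> over the path \<open>d(-, b)\<close> connects them, and the paths
  \<open>R\<close> follow it.  Since \<open>d\<close> is an arbitrary homotopy, this also absorbs loops.
\<close>

lemma inl_inr_phomotopic:
  assumes d: "phomotopy B X (\<iota> \<circ> j) (g \<circ> k) d"
    and R: "continuous_map (prod_topology I01 (prod_topology I01 (ptop W))) (ptop X) R"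
    and Rl: "\<And>s w. 0 \<le> s \<Longrightarrow> s \<le> 1 \<Longrightarrow> w \<in> pts W \<Longrightarrow> R (s, (0, w)) = \<iota> (\<eta> w)"
    and Rr: "\<And>s w. 0 \<le> s \<Longrightarrow> s \<le> 1 \<Longrightarrow> w \<in> pts W \<Longrightarrow> R (s, (1, w)) = d (s, \<beta> w)"
    and Rb: "\<And>s u. 0 \<le> s \<Longrightarrow> s \<le> 1 \<Longrightarrow> 0 \<le> u \<Longrightarrow> u \<le> 1 \<Longrightarrow> R (s, (u, pbase W)) = pbase X"
    and R0: "\<And>u w. 0 \<le> u \<Longrightarrow> u \<le> 1 \<Longrightarrow> w \<in> pts W \<Longrightarrow> R (0, (u, w)) = R0 (u, w)"
    and R1: "\<And>u w. 0 \<le> u \<Longrightarrow> u \<le> 1 \<Longrightarrow> w \<in> pts W \<Longrightarrow> R (1, (u, w)) = R1 (u, w)"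
  shows "phomotopic (hpo W A B \<eta> \<beta>) J'
    (square_map l' r' c' \<eta> \<beta> (l \<circ> j) R0) (square_map l' r' c' \<eta> \<beta> (r \<circ> k) R1)"
proof (rule J2.square_map_phomotopic[OF W B eta beta _ R Rl _ Rb R0 R1])
  have d': "phomotopy B X (\<iota> \<circ> j) (g \<circ> k \<circ> id) d" using d by simp
  show "phomotopy B J (l \<circ> j) (r \<circ> k) (\<lambda>(t, b). c (t, hpb_whisker j k d b))"
    using phomotopy_square_map[OF B B j pmap_id k d'] by simp
  fix s :: real and w assume s: "0 \<le> s" "s \<le> 1" and w: "w \<in> pts W"
  have b: "\<beta> w \<in> pts B" using pmapD(3)[OF beta w] .
  have "e (c (s, hpb_whisker j k d (\<beta> w))) = d (s, \<beta> w)"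
    by (rule whisker_line_ends(3)[OF _ _ b phomotopyD(1)[OF d]])
       (use b s pmapD(3)[OF j] pmapD(3)[OF k] phomotopyD[OF d] in auto)
  then show "R (s, (1, w)) = e ((\<lambda>(t, b). c (t, hpb_whisker j k d b)) (s, \<beta> w))"
    using Rr[OF s w] by simp
qed auto

text \<open>
  Pushing along the join lines replaces \<open>k\<close> by \<open>r \<circ> k\<close>, and over constant paths \<open>r \<circ> k\<close> can be
  replaced by \<open>l \<circ> j\<close>.
\<close>

lemma inr_square_map_phomotopic:
  assumes jk: "\<And>b. b \<in> pts B \<Longrightarrow> g (k b) = \<iota> (j b)"
    and Q: "phomotopy W X (\<iota> \<circ> \<eta>) (\<iota> \<circ> j \<circ> \<beta>) Q"
  shows "phomotopic (hpo W A B \<eta> \<beta>) J'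
    (r' \<circ> square_map l r c \<eta> \<beta> k Q) (square_map l' r' c' \<eta> \<beta> (l \<circ> j) Q)"
proof -
  have Q': "phomotopy W X (\<iota> \<circ> \<eta>) (g \<circ> k \<circ> \<beta>) Q"
    using Q pmapD(3)[OF beta] by (simp add: phomotopy_def jk)
  have fr: "continuous_map (prod_topology I01 (prod_topology I01 (ptop W))) I01 (\<lambda>z. fst z * fst (snd z))"
    unfolding continuous_map_into_I01
    by (auto intro!: continuous_map_real_mult continuous_map_into_fulltopology[OF continuous_map_fst]
        continuous_map_into_fulltopology[OF continuous_map_triple_projections(1)] mult_le_one)
  have c1: "continuous_map (prod_topology I01 (prod_topology I01 (ptop W))) (ptop X)
      (\<lambda>(s, (u, w)). Q (s * u, w))"
    using continuous_map_app2[OF phomotopyD(1)[OF Q] fr continuous_map_triple_projections(2)]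
    by (simp add: case_prod_unfold)
  have c2: "continuous_map (prod_topology I01 (prod_topology I01 (ptop W))) (ptop X) (\<lambda>(s, z). Q z)"
    using continuous_map_app[OF phomotopyD(1)[OF Q] continuous_map_snd]
    by (simp add: case_prod_unfold)
  let ?\<phi> = "square_map l r c \<eta> \<beta> k Q"
  have "phomotopic (hpo W A B \<eta> \<beta>) J' (r' \<circ> ?\<phi>) (square_map l' r' c' \<eta> \<beta> (?\<phi> \<circ> hpo_inr A B) Q)"
  proof (rule J2.inr_phomotopic_square_map[OF W B eta beta pmap_square_map[OF W B eta beta k Q'] _ c1])
    have "continuous_map (prod_topology I01 (ptop A)) (ptop X) (\<lambda>(u, a). \<iota> a)"
      using continuous_map_app[OF pmapD(1)[OF iota] continuous_map_snd] by (simp add: case_prod_unfold)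
    then show "phomotopy A X \<iota> (\<lambda>a. e (?\<phi> (hpo_inl a))) (\<lambda>(u, a). \<iota> a)"
      using pmapD(2)[OF iota] by (simp add: phomotopy_def e_square_map(1)[OF W B eta beta k Q'])
  qed (use phomotopyD[OF Q] in \<open>auto simp: e_square_map[OF W B eta beta k Q'] mult_le_one\<close>)
  moreover have "?\<phi> \<circ> hpo_inr A B = r \<circ> k"
    by (rule ext) (simp add: square_map_inr[OF W B eta beta k Q'])
  moreover have "phomotopic (hpo W A B \<eta> \<beta>) J'
      (square_map l' r' c' \<eta> \<beta> (l \<circ> j) Q) (square_map l' r' c' \<eta> \<beta> (r \<circ> k) Q)"
  proof (rule inl_inr_phomotopic[OF _ c2])
    have "continuous_map (prod_topology I01 (ptop B)) (ptop X) (\<lambda>(u, b). \<iota> (j b))"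
      using continuous_map_app[OF pmapD(1)[OF pmap_comp[OF j iota]] continuous_map_snd[of I01 "ptop B"]]
      by (simp add: case_prod_unfold)
    then show "phomotopy B X (\<iota> \<circ> j) (g \<circ> k) (\<lambda>(u, b). \<iota> (j b))"
      using pmapD(2)[OF iota] pmapD(2)[OF j] by (simp add: phomotopy_def jk)
  qed (use phomotopyD[OF Q] in auto)
  ultimately show ?thesis
    using phomotopic_sym phomotopic_trans by metis
qed

end

end

text \<open>
  Clamping the time parameter extends a homotopy to all real times.  Concatenations are
  then functions on the whole line, and reparametrising them needs no conditions on the
  range.
\<close>

definition clamp01 :: "real \<Rightarrow> real" where
  "clamp01 v = max 0 (min 1 v)"

lemma clamp01_simps [simp]:
  "v \<le> 0 \<Longrightarrow> clamp01 v = 0" "0 \<le> v \<Longrightarrow> v \<le> 1 \<Longrightarrow> clamp01 v = v" "1 \<le> v \<Longrightarrow> clamp01 v = 1"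
  "0 \<le> clamp01 v" "clamp01 v \<le> 1"
  by (auto simp: clamp01_def)

lemma continuous_map_clamp01:
  "continuous_map Z euclideanreal v \<Longrightarrow> continuous_map Z I01 (\<lambda>z. clamp01 (v z))"
  unfolding continuous_map_into_I01 by (auto simp: clamp01_def intro!: continuous_intros)

lemma continuous_map_paste:
  assumes "continuous_map (prod_topology euclideanreal P) R a" "continuous_map (prod_topology euclideanreal P) R b"
    and "\<And>x. x \<in> topspace P \<Longrightarrow> a (1, x) = b (1, x)"
  shows "continuous_map (prod_topology euclideanreal P) R (\<lambda>z. if fst z \<le> 1 then a z else b z)"
  by (rule continuous_map_cases_le) (use assms in \<open>auto intro: continuous_map_fst continuous_map_from_subtopology\<close>)

text \<open>
  The data of a homotopy section \<open>\<sigma>\<close> of \<open>y\<close>, with a homotopy \<open>K\<close> witnessing this and a homotopy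
  \<open>L\<close> from \<open>\<sigma> \<circ> \<iota> \<circ> j\<close> to a map \<open>k\<close>.  The composite \<open>\<iota> \<circ> j\<close> plays the role of the right
  leg of the square \<open>Q\<close>.
\<close>

locale section_homotopies =
  fixes A :: "'a pspace" and X :: "'x pspace" and Y :: "'y pspace" and W :: "'w pspace" and B :: "'b pspace"
    and \<iota> y \<sigma> \<eta> \<beta> j k K L Q
  assumes W: "pointed_space W" and B: "pointed_space B"
    and eta: "pmap W A \<eta>" and beta: "pmap W B \<beta>" and j: "pmap B A j"
    and A: "pointed_space A" and iota: "pmap A X \<iota>" and y: "pmap Y X y" and \<sigma>: "pmap X Y \<sigma>"
    and Q: "phomotopy W X (\<iota> \<circ> \<eta>) (\<iota> \<circ> j \<circ> \<beta>) Q"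
    and K: "phomotopy X X id (y \<circ> \<sigma>) K"
    and L: "phomotopy B Y (\<sigma> \<circ> \<iota> \<circ> j) k L"
begin

text \<open>
  For \<open>v\<close> in \<open>{0..2}\<close> this is \<open>K\<close> at \<open>\<iota> (j b)\<close> followed by \<open>y \<circ> L\<close>, a path from \<open>\<iota> (j b)\<close> to
  \<open>y (k b)\<close>.  If \<open>y \<circ> k = \<iota> \<circ> j\<close>, it is the loop that measures the discrepancy of the two homotopies.
\<close>

definition drift :: "real \<times> 'b \<Rightarrow> 'x" where
  "drift z = (if fst z \<le> 1 then K (clamp01 (fst z), \<iota> (j (snd z)))
     else y (L (clamp01 (fst z - 1), snd z)))"

text \<open>
  Run up to time 1, 2 and 3, this is the path over \<open>w\<close> before the homotopies are used, after \<open>K\<close> has been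
  used, and after both have been used.
\<close>

definition track :: "real \<times> 'w \<Rightarrow> 'x" where
  "track z = (if fst z \<le> 1 then Q (clamp01 (fst z), snd z) else drift (fst z - 1, \<beta> (snd z)))"

lemma iota_j: "pmap B X (\<iota> \<circ> j)"
  by (rule pmap_comp[OF j iota])

lemma iota_j_pts: "b \<in> pts B \<Longrightarrow> \<iota> (j b) \<in> pts X"
  using pmapD(3)[OF iota_j] by simp

lemma continuous_map_drift: "continuous_map (prod_topology euclideanreal (ptop B)) (ptop X) drift"
  unfolding drift_def
proof (rule continuous_map_paste)
  show "continuous_map (prod_topology euclideanreal (ptop B)) (ptop X)
      (\<lambda>z. K (clamp01 (fst z), \<iota> (j (snd z))))"
    using continuous_map_app2[OF phomotopyD(1)[OF K] continuous_map_clamp01[OF continuous_map_fst]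
      continuous_map_app[OF pmapD(1)[OF iota_j] continuous_map_snd]] by simp
  have "continuous_map (prod_topology euclideanreal (ptop B)) euclideanreal (\<lambda>z. fst z - 1)"
    by (intro continuous_intros)
  then show "continuous_map (prod_topology euclideanreal (ptop B)) (ptop X)
      (\<lambda>z. y (L (clamp01 (fst z - 1), snd z)))"
    by (intro continuous_map_app[OF pmapD(1)[OF y]] continuous_map_app2[OF phomotopyD(1)[OF L]]
        continuous_map_clamp01 continuous_map_snd)
qed (use phomotopyD(3)[OF K] phomotopyD(2)[OF L] iota_j_pts in auto)

lemma drift_simps:
  "b \<in> pts B \<Longrightarrow> v \<le> 0 \<Longrightarrow> drift (v, b) = \<iota> (j b)"
  "v \<le> 1 \<Longrightarrow> drift (v, b) = K (clamp01 v, \<iota> (j b))"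
  "b \<in> pts B \<Longrightarrow> 1 \<le> v \<Longrightarrow> drift (v, b) = y (L (clamp01 (v - 1), b))"
  "b \<in> pts B \<Longrightarrow> 2 \<le> v \<Longrightarrow> drift (v, b) = y (k b)"
  "drift (v, pbase B) = pbase X"
  using phomotopyD(2,3)[OF K] phomotopyD[OF L] iota_j_pts pmapD(2)[OF iota_j] phomotopyD(4)[OF K]
    pmapD(2)[OF y]
  by (auto simp: drift_def)

lemma continuous_map_track: "continuous_map (prod_topology euclideanreal (ptop W)) (ptop X) track"
  unfolding track_def
proof (rule continuous_map_paste)
  show "continuous_map (prod_topology euclideanreal (ptop W)) (ptop X) (\<lambda>z. Q (clamp01 (fst z), snd z))"
    by (intro continuous_map_app2[OF phomotopyD(1)[OF Q]] continuous_map_clamp01 continuous_map_fst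
        continuous_map_snd)
  have "continuous_map (prod_topology euclideanreal (ptop W)) euclideanreal (\<lambda>z. fst z - 1)"
    by (intro continuous_intros)
  then show "continuous_map (prod_topology euclideanreal (ptop W)) (ptop X)
      (\<lambda>z. drift (fst z - 1, \<beta> (snd z)))"
    by (intro continuous_map_app2[OF continuous_map_drift]
        continuous_map_app[OF pmapD(1)[OF beta] continuous_map_snd])
qed (use phomotopyD(3)[OF Q] pmapD(3)[OF beta] in \<open>auto simp: drift_simps(1)\<close>)

lemma track_simps:
  "w \<in> pts W \<Longrightarrow> v \<le> 0 \<Longrightarrow> track (v, w) = \<iota> (\<eta> w)"
  "0 \<le> v \<Longrightarrow> v \<le> 1 \<Longrightarrow> track (v, w) = Q (v, w)"
  "w \<in> pts W \<Longrightarrow> 1 \<le> v \<Longrightarrow> track (v, w) = drift (v - 1, \<beta> w)"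
  "track (v, pbase W) = pbase X"
  using phomotopyD[OF Q] pmapD[OF beta] by (auto simp: track_def drift_simps(1,5))

lemma continuous_map_track_app:
  assumes "continuous_map (prod_topology I01 (prod_topology I01 (ptop W))) euclideanreal (\<lambda>z. v (fst z) (fst (snd z)))"
  shows "continuous_map (prod_topology I01 (prod_topology I01 (ptop W))) (ptop X) (\<lambda>(s, (u, w)). track (v s u, w))"
  unfolding case_prod_unfold
  by (rule continuous_map_app2[OF continuous_map_track assms continuous_map_triple_projections(2)])

lemma real_parameters:
  "continuous_map (prod_topology I01 (prod_topology I01 (ptop W))) euclideanreal fst"
  "continuous_map (prod_topology I01 (prod_topology I01 (ptop W))) euclideanreal (\<lambda>z. fst (snd z))"
  by (rule continuous_map_into_fulltopology[OF continuous_map_fst],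
      rule continuous_map_into_fulltopology[OF continuous_map_triple_projections(1)])

definition cylinder_proj :: "('w, 'a, 'b) dcyl \<Rightarrow> 'x" where
  "cylinder_proj = hpo_whisker \<iota> (\<iota> \<circ> j) Q"

lemma cylinder_proj_simps:
  "cylinder_proj (hpo_inl a) = \<iota> a" "cylinder_proj (hpo_inr A B b) = \<iota> (j b)"
  "0 \<le> t \<Longrightarrow> t \<le> 1 \<Longrightarrow> w \<in> pts W \<Longrightarrow> cylinder_proj (hpo_htpy W A B \<eta> \<beta> (t, w)) = Q (t, w)"
  unfolding cylinder_proj_def
  using hpo_whisker_phomotopy_inr[OF eta beta iota iota_j Q]
    hpo_whisker_phomotopy_htpy[OF eta beta iota iota_j Q]
  by (simp_all add: hpo_whisker_def hpo_inl_def)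

lemma pmap_cylinder_proj: "pmap (hpo W A B \<eta> \<beta>) X cylinder_proj"
  unfolding cylinder_proj_def by (rule pmap_hpo_whisker[OF eta beta iota iota_j Q])

text \<open>
  Pushing \<open>\<sigma> \<circ> cylinder_proj\<close> along the join lines, with path \<open>Q\<close> followed by \<open>K\<close>, gives the square
  map with \<open>k = \<sigma> \<circ> \<iota> \<circ> j\<close>.  Moving this \<open>k\<close> along \<open>L\<close> lengthens the path by \<open>y \<circ> L\<close>.
\<close>

lemma inr_section_phomotopic:
  assumes J: "fibre_join A Y X \<iota> y J l r c e"
  shows "phomotopic (hpo W A B \<eta> \<beta>) J (r \<circ> \<sigma> \<circ> cylinder_proj)
    (square_map l r c \<eta> \<beta> k (\<lambda>(u, w). track (3 * u, w)))"
proof -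
  interpret J: fibre_join A Y X \<iota> y J l r c e by (rule J)
  let ?Z = "prod_topology I01 (prod_topology I01 (ptop W))"
  let ?\<phi> = "\<sigma> \<circ> cylinder_proj"
  \<comment> \<open>the first half of the path in \<open>M\<close> is \<open>Q\<close> restricted to \<open>{0..s}\<close>, the second half is \<open>K\<close> at its
    end point \<open>Q (s, w)\<close>\<close>
  have 1: "phomotopic (hpo W A B \<eta> \<beta>) J (r \<circ> ?\<phi>)
      (square_map l r c \<eta> \<beta> (?\<phi> \<circ> hpo_inr A B) (\<lambda>(u, w). track (2 * u, w)))"
  proof (rule J.inr_phomotopic_square_map[OF W B eta beta pmap_comp[OF pmap_cylinder_proj \<sigma>],
        where m = "\<lambda>(u, a). K (clamp01 (2 * u - 1), \<iota> a)"
          and M = "\<lambda>(s, (u, w)). K (clamp01 (2 * u - 1), Q (clamp01 (s * min 1 (2 * u)), w))"])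
    have "continuous_map (prod_topology I01 (ptop A)) euclideanreal (\<lambda>z. 2 * fst z - 1)"
      by (intro continuous_intros continuous_map_into_fulltopology[OF continuous_map_fst])
    then have "continuous_map (prod_topology I01 (ptop A)) (ptop X) (\<lambda>(u, a). K (clamp01 (2 * u - 1), \<iota> a))"
      unfolding case_prod_unfold
      by (intro continuous_map_app2[OF phomotopyD(1)[OF K]] continuous_map_clamp01
          continuous_map_app[OF pmapD(1)[OF iota] continuous_map_snd])
    then show "phomotopy A X \<iota> (\<lambda>a. y (?\<phi> (hpo_inl a))) (\<lambda>(u, a). K (clamp01 (2 * u - 1), \<iota> a))"
      using phomotopyD[OF K] pmapD[OF iota] by (simp add: phomotopy_def cylinder_proj_simps)
    have "continuous_map ?Z euclideanreal (\<lambda>z. 2 * fst (snd z) - 1)"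
      "continuous_map ?Z euclideanreal (\<lambda>z. fst z * min 1 (2 * fst (snd z)))"
      by (intro continuous_intros real_parameters)+
    then show "continuous_map ?Z (ptop X)
        (\<lambda>(s, (u, w)). K (clamp01 (2 * u - 1), Q (clamp01 (s * min 1 (2 * u)), w)))"
      unfolding case_prod_unfold
      by (intro continuous_map_app2[OF phomotopyD(1)[OF K]] continuous_map_app2[OF phomotopyD(1)[OF Q]]
          continuous_map_clamp01 continuous_map_triple_projections(2))
  next
    fix u w assume u: "0 \<le> u" "u \<le> (1::real)" and w: "w \<in> pts W"
    have "Q (v, w) \<in> pts X" if "0 \<le> v" "v \<le> 1" for v
      using phomotopyD(5)[OF Q that w] .
    moreover have "\<beta> w \<in> pts B" using pmapD(3)[OF beta w] .
    ultimately show "(\<lambda>(s, (u, w)). K (clamp01 (2 * u - 1), Q (clamp01 (s * min 1 (2 * u)), w))) (1, (u, w)) =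
        (\<lambda>(u, w). track (2 * u, w)) (u, w)"
      using phomotopyD(2)[OF K] phomotopyD(3)[OF Q w] u
      by (cases "2 * u \<le> 1") (auto simp: track_simps(2) track_simps(3)[OF w] drift_simps(2))
  qed (use phomotopyD[OF K] phomotopyD[OF Q] pmapD(3)[OF iota] pmapD(3)[OF eta] in \<open>auto simp: cylinder_proj_simps\<close>)
  have 2: "?\<phi> \<circ> hpo_inr A B = \<sigma> \<circ> \<iota> \<circ> j" by (rule ext) (simp add: cylinder_proj_simps)
  have "phomotopic (hpo W A B \<eta> \<beta>) J
      (square_map l r c \<eta> \<beta> (\<sigma> \<circ> \<iota> \<circ> j) (\<lambda>(u, w). track (2 * u, w)))
      (square_map l r c \<eta> \<beta> k (\<lambda>(u, w). track (3 * u, w)))"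
    by (rule J.square_map_phomotopic[OF W B eta beta L, where Q = "\<lambda>(s, (u, w)). track ((2 + s) * u, w)"])
       (auto simp: track_simps drift_simps(3) phomotopyD(2)[OF Q] pmapD(3)[OF beta]
         intro!: continuous_map_track_app continuous_intros real_parameters)
  with 1 show ?thesis unfolding 2 by (simp add: comp_assoc phomotopic_trans)
qed

end

text \<open>
  If the section is defined on a join \<open>Y\<close> and \<open>\<sigma> \<circ> \<iota> \<circ> j\<close> is homotopic to \<open>r \<circ> k\<close>, then the
  drift is a loop, and the join lines of \<open>Y\<close> over this loop turn \<open>r \<circ> k\<close> into \<open>l \<circ> j\<close> while they shorten the
  track back to \<open>Q\<close>.
\<close>

lemma inr_section_phomotopic_square_map:
  assumes J1: "fibre_join A G X \<iota> g Y l r c y" and J2: "fibre_join A Y X \<iota> y J l' r' c' e'"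
    and W: "pointed_space W" and B: "pointed_space B"
    and eta: "pmap W A \<eta>" and beta: "pmap W B \<beta>" and j: "pmap B A j" and k: "pmap B G k"
    and jk: "\<And>b. b \<in> pts B \<Longrightarrow> g (k b) = \<iota> (j b)"
    and Q: "phomotopy W X (\<iota> \<circ> \<eta>) (\<iota> \<circ> j \<circ> \<beta>) Q"
    and \<sigma>: "homotopy_section Y X y \<sigma>" and L: "phomotopic B Y (\<sigma> \<circ> \<iota> \<circ> j) (r \<circ> k)"
  shows "phomotopic (hpo W A B \<eta> \<beta>) J (r' \<circ> \<sigma> \<circ> hpo_whisker \<iota> (\<iota> \<circ> j) Q)
    (square_map l' r' c' \<eta> \<beta> (l \<circ> j) Q)"
proof -
  interpret J1: fibre_join A G X \<iota> g Y l r c y by (rule J1)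
  interpret J2: fibre_join A Y X \<iota> y J l' r' c' e' by (rule J2)
  obtain L where L: "phomotopy B Y (\<sigma> \<circ> \<iota> \<circ> j) (r \<circ> k) L"
    using L phomotopic_iff[OF B] by blast
  have \<sigma>': "pmap X Y \<sigma>" "phomotopic X X id (y \<circ> \<sigma>)"
    using \<sigma> by (auto simp: homotopy_section_def intro: phomotopic_sym)
  obtain K where K: "phomotopy X X id (y \<circ> \<sigma>) K"
    using \<sigma>'(2) phomotopic_iff[OF J1.X] by blast
  interpret S: section_homotopies A X Y W B \<iota> y \<sigma> \<eta> \<beta> j "r \<circ> k" K L Q
    by unfold_locales (fact W B eta beta j J1.A J1.iota J1.e \<sigma>' Q K L)+
  have "phomotopic (hpo W A B \<eta> \<beta>) J (square_map l' r' c' \<eta> \<beta> (l \<circ> j) Q)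
      (square_map l' r' c' \<eta> \<beta> (r \<circ> k) (\<lambda>(u, w). S.track (3 * u, w)))"
  proof (rule J1.inl_inr_phomotopic[OF J2 W B eta beta j k,
        where d = "\<lambda>(s, b). S.drift (2 * s, b)" and R = "\<lambda>(s, (u, w)). S.track ((1 + 2 * s) * u, w)"])
    have "continuous_map (prod_topology I01 (ptop B)) euclideanreal (\<lambda>z. 2 * fst z)"
      by (intro continuous_intros continuous_map_into_fulltopology[OF continuous_map_fst])
    then have "continuous_map (prod_topology I01 (ptop B)) (ptop X) (\<lambda>(s, b). S.drift (2 * s, b))"
      unfolding case_prod_unfold
      by (intro continuous_map_app2[OF S.continuous_map_drift] continuous_map_snd)
    then show "phomotopy B X (\<iota> \<circ> j) (g \<circ> k) (\<lambda>(s, b). S.drift (2 * s, b))"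
      using pmapD(3)[OF k] by (simp add: phomotopy_def S.drift_simps(1,4,5) J1.e_r)
  qed (auto simp: S.track_simps phomotopyD(2)[OF Q] pmapD(3)[OF beta]
         intro!: S.continuous_map_track_app continuous_intros S.real_parameters)
  then show ?thesis
    using S.inr_section_phomotopic[OF J2] unfolding S.cylinder_proj_def
    by (blast intro: phomotopic_sym phomotopic_trans)
qed

lemma fibre_join_standard:
  assumes A: "pointed_space A" and G: "pointed_space G" and X: "pointed_space X"
    and iota: "pmap A X \<iota>" and g: "pmap G X g"
  shows "fibre_join A G X \<iota> g (hpo (hpb A G X \<iota> g) A G hpb_fst hpb_snd)
    hpo_inl (hpo_inr A G) (hpo_htpy (hpb A G X \<iota> g) A G hpb_fst hpb_snd) (hpo_whisker \<iota> g hpb_htpy)"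
proof -
  note F = pointed_hpb[OF A G X iota g] and p = pmap_hpb_fst[of A G X \<iota> g] pmap_hpb_snd[of A G X \<iota> g]
    and h = phomotopy_hpb_htpy[OF iota g]
  show ?thesis
  proof
    fix t z assume t: "0 \<le> t" "t \<le> (1::real)" and z: "z \<in> pts (hpb A G X \<iota> g)"
    show "hpo_whisker \<iota> g hpb_htpy (hpo_htpy (hpb A G X \<iota> g) A G hpb_fst hpb_snd (t, z)) = fst (snd z) t"
      using hpo_whisker_phomotopy_htpy[OF p iota g h t z] by (simp add: hpb_htpy_def case_prod_unfold)
  qed (simp_all add: A G X iota g pointed_hpo[OF A p] pmap_hpo_inl[OF p] pmap_hpo_inr[OF p]
      phomotopy_hpo_htpy[OF p] pmap_hpo_whisker[OF p iota g h] hpo_whisker_phomotopy_inr[OF p iota g h])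
qed

text \<open>
  The case in which the join has a second factor \<open>B\<close> whose projection to \<open>X\<close> factors through \<open>A\<close>, and \<open>\<sigma>\<close>
  is a two-sided homotopy inverse of that projection.  The map
  \<open>hpo_inr A B \<circ> \<sigma> \<circ> e\<close>, where \<open>e\<close> is the projection of the join, appends the drift to each path, up
  to homotopy.
  Appending the reversed drift afterwards gives a map homotopic to the identity, hence a homotopy left
  inverse of \<open>e\<close>, which has to agree with the right inverse \<open>hpo_inr A B \<circ> \<sigma>\<close>.
\<close>

lemma inr_section_phomotopic_id:
  fixes A :: "'a pspace" and B :: "'b pspace" and X :: "'x pspace"
  assumes A: "pointed_space A" and B: "pointed_space B" and X: "pointed_space X"
    and iota: "pmap A X \<iota>" and j: "pmap B A j"
    and \<sigma>: "homotopy_section B X (\<iota> \<circ> j) \<sigma>" and L: "phomotopic B B (\<sigma> \<circ> \<iota> \<circ> j) id"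
  defines "F \<equiv> hpb A B X \<iota> (\<iota> \<circ> j)"
  defines "P \<equiv> hpo F A B hpb_fst hpb_snd"
  shows "phomotopic P P (hpo_inr A B \<circ> \<sigma> \<circ> hpo_whisker \<iota> (\<iota> \<circ> j) hpb_htpy) id"
proof -
  note y = pmap_comp[OF j iota]
  let ?c = "hpo_htpy F A B hpb_fst hpb_snd"
  interpret J: fibre_join A B X \<iota> "\<iota> \<circ> j" P hpo_inl "hpo_inr A B" ?c "hpo_whisker \<iota> (\<iota> \<circ> j) hpb_htpy"
    unfolding P_def F_def by (rule fibre_join_standard[OF A B X iota y])
  note F = pointed_hpb[OF A B X iota y, folded F_def]
    and fst = pmap_hpb_fst[of A B X \<iota> "\<iota> \<circ> j", folded F_def]
    and snd = pmap_hpb_snd[of A B X \<iota> "\<iota> \<circ> j", folded F_def]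
    and Q = phomotopy_hpb_htpy[OF iota y, folded F_def]
  obtain L where L: "phomotopy B B (\<sigma> \<circ> \<iota> \<circ> j) id L"
    using L phomotopic_iff[OF B] by blast
  have \<sigma>': "pmap X B \<sigma>" "phomotopic X X id ((\<iota> \<circ> j) \<circ> \<sigma>)"
    using \<sigma> by (auto simp: homotopy_section_def intro: phomotopic_sym)
  obtain K where K: "phomotopy X X id ((\<iota> \<circ> j) \<circ> \<sigma>) K"
    using \<sigma>'(2) phomotopic_iff[OF X] by blast
  interpret S: section_homotopies A X B F B \<iota> "\<iota> \<circ> j" \<sigma> hpb_fst hpb_snd j id K L hpb_htpy
    by unfold_locales (fact F B fst snd j A iota y \<sigma>' Q K L)+
  have P: "pointed_space P" by (rule J.J)
  let ?sq = "square_map hpo_inl (hpo_inr A B) ?c hpb_fst hpb_snd id"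
  have F_pts: "(a, p, b) \<in> pts F \<longleftrightarrow> a \<in> pts A \<and> p \<in> path_set (ptop X) \<and> b \<in> pts B \<and> p 0 = \<iota> a \<and> p 1 = \<iota> (j b)"
    for a p b by (simp add: F_def topspace_hpb)
  have ends: "hpb_htpy (0, w) = \<iota> (hpb_fst w)" "hpb_htpy (1, w) = \<iota> (j (hpb_snd w))" "hpb_fst w \<in> pts A"
    "hpb_snd w \<in> pts B" if "w \<in> pts F" for w
    using that pmapD(3)[OF fst] pmapD(3)[OF snd] phomotopyD(2,3)[OF Q] by auto
  have base: "hpb_snd (pbase F) = pbase B" "hpb_fst (pbase F) = pbase A"
    using pmapD(2)[OF fst] pmapD(2)[OF snd] by auto
  \<comment> \<open>\<open>Q'\<close> appends the reversed drift, \<open>T\<close> appends the drift, and \<open>T2\<close> appends the drift and then its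
    reverse: the track runs forward from 0 to 3 until time \<open>1 / 2\<close> and then back to 1, which is the
    minimum of the two linear functions\<close>
  define T where "T = (\<lambda>z :: real \<times> 'a \<times> (real \<Rightarrow> 'x) \<times> 'b. S.track (3 * fst z, snd z))"
  define T2 where "T2 = (\<lambda>z :: real \<times> 'a \<times> (real \<Rightarrow> 'x) \<times> 'b. S.track (min (6 * fst z) (5 - 4 * fst z), snd z))"
  define Q' where "Q' = (\<lambda>z :: real \<times> 'a \<times> (real \<Rightarrow> 'x) \<times> 'b. if fst z \<le> 1 / 2 then hpb_htpy (clamp01 (2 * fst z), snd z)
      else S.drift (4 - 4 * fst z, hpb_snd (snd z)))"
  have fr: "continuous_map (prod_topology I01 (ptop F)) euclideanreal fst"
    by (rule continuous_map_into_fulltopology[OF continuous_map_fst])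
  have "continuous_map (prod_topology I01 (ptop F)) euclideanreal (\<lambda>z. 3 * fst z)"
    "continuous_map (prod_topology I01 (ptop F)) euclideanreal (\<lambda>z. min (6 * fst z) (5 - 4 * fst z))"
    by (intro continuous_intros fr)+
  then have "continuous_map (prod_topology I01 (ptop F)) (ptop X) T"
    "continuous_map (prod_topology I01 (ptop F)) (ptop X) T2"
    unfolding T_def T2_def
    by (auto intro!: continuous_map_app2[OF S.continuous_map_track] continuous_map_snd)
  then have T: "phomotopy F X (\<iota> \<circ> hpb_fst) (\<iota> \<circ> j \<circ> id \<circ> hpb_snd) T"
    and T2: "phomotopy F X (\<iota> \<circ> hpb_fst) (\<iota> \<circ> j \<circ> id \<circ> hpb_snd) T2"
    using pmapD(3)[OF snd] ends by (auto simp: phomotopy_def T_def T2_def S.track_simps S.drift_simps(1,4,5))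
  have "continuous_map (prod_topology I01 (ptop F)) (ptop X) Q'"
    unfolding Q'_def
  proof (rule continuous_map_cases_le[OF fr])
    have c2: "continuous_map (prod_topology I01 (ptop F)) euclideanreal (\<lambda>z. 2 * fst z)"
      and c4: "continuous_map (prod_topology I01 (ptop F)) euclideanreal (\<lambda>z. 4 - 4 * fst z)"
      by (intro continuous_intros fr)+
    have "continuous_map (prod_topology I01 (ptop F)) (ptop X) (\<lambda>z. hpb_htpy (clamp01 (2 * fst z), snd z))"
      "continuous_map (prod_topology I01 (ptop F)) (ptop X) (\<lambda>z. S.drift (4 - 4 * fst z, hpb_snd (snd z)))"
      by (rule continuous_map_app2[OF phomotopyD(1)[OF Q] continuous_map_clamp01[OF c2] continuous_map_snd])
         (rule continuous_map_app2[OF S.continuous_map_drift c4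
            continuous_map_app[OF pmapD(1)[OF snd] continuous_map_snd]])
    then show "continuous_map (subtopology (prod_topology I01 (ptop F)) {x \<in> topspace (prod_topology I01 (ptop F)). fst x \<le> 1 / 2})
        (ptop X) (\<lambda>z. hpb_htpy (clamp01 (2 * fst z), snd z))"
      "continuous_map (subtopology (prod_topology I01 (ptop F)) {x \<in> topspace (prod_topology I01 (ptop F)). 1 / 2 \<le> fst x})
        (ptop X) (\<lambda>z. S.drift (4 - 4 * fst z, hpb_snd (snd z)))"
      by (auto intro: continuous_map_from_subtopology)
    fix z assume "z \<in> topspace (prod_topology I01 (ptop F))" and half: "fst z = 1 / 2"
    then have "snd z \<in> pts F" by auto
    then show "hpb_htpy (clamp01 (2 * fst z), snd z) = S.drift (4 - 4 * fst z, hpb_snd (snd z))"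
      unfolding half using ends[of "snd z"] by (simp add: S.drift_simps(4))
  qed auto
  then have Q': "phomotopy F X (\<iota> \<circ> hpb_fst) (\<iota> \<circ> j \<circ> id \<circ> hpb_snd) Q'"
    using phomotopyD(4)[OF Q] by (auto simp: phomotopy_def Q'_def ends S.drift_simps(1,4,5) base)
  have Q0: "phomotopy F X (\<iota> \<circ> hpb_fst) (\<iota> \<circ> j \<circ> id \<circ> hpb_snd) hpb_htpy" using Q by simp
  note sq = J.square_map_inl[OF F B fst snd pmap_id] J.square_map_inr[OF F B fst snd pmap_id]
     J.square_map_htpy[OF F B fst snd pmap_id]
  have W': "hpb_whisker hpb_fst (id \<circ> hpb_snd) T w \<in> pts F" if "w \<in> pts F" for w
  proof -
    have "continuous_map (ptop F) (ptop F) (hpb_whisker hpb_fst (id \<circ> hpb_snd) T)"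
      unfolding F_def
      by (rule continuous_map_hpb_whisker; fold F_def)
         (use phomotopyD(1,2,3)[OF T] pmapD(1)[OF fst] pmapD(1)[OF snd] in auto)
    with that show ?thesis by (auto simp: continuous_map_def)
  qed
  have comp: "?sq Q' (?sq T z) = ?sq T2 z" if "z \<in> pts P" for z
    using that unfolding P_def
  proof (cases rule: hpo_point_cases[OF fst snd, consumes 1, case_names inl inr htpy])
    case (inl a) then show ?thesis by (simp add: sq[OF T] sq[OF T2] sq[OF Q'])
  next
    case (inr b) then show ?thesis by (simp add: sq[OF T] sq[OF T2] sq[OF Q'])
  next
    case (htpy t w)
    let ?w = "hpb_whisker hpb_fst (id \<circ> hpb_snd) T w"
    have "hpb_whisker hpb_fst (id \<circ> hpb_snd) Q' ?w = hpb_whisker hpb_fst (id \<circ> hpb_snd) T2 w"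
    proof (rule hpb_whisker_eqI)
      fix u :: real assume u: "0 \<le> u" "u \<le> 1"
      have "hpb_htpy (t, ?w) = T (t, w)" if "0 \<le> t" "t \<le> 1" for t
        using that by (simp add: hpb_htpy_def hpb_whisker_def)
      moreover have "hpb_snd ?w = hpb_snd w" by (simp add: hpb_whisker_def)
      ultimately       show "Q' (u, ?w) = T2 (u, w)"
        using u htpy(3)
        by (auto simp: Q'_def T_def T2_def S.track_simps(3) min_def)
    qed (auto simp: hpb_whisker_def)
    then show ?thesis
      by (simp only: htpy(4) sq(3)[OF T htpy(1,2,3)] sq(3)[OF T2 htpy(1,2,3)] sq(3)[OF Q' htpy(1,2) W'[OF htpy(3)]])
  qed
  have sq_id: "?sq hpb_htpy z = z" if "z \<in> pts P" for z
    using that unfolding P_def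
  proof (cases rule: hpo_point_cases[OF fst snd, consumes 1, case_names inl inr htpy])
    case (htpy t w)
    have "hpb_whisker hpb_fst (id \<circ> hpb_snd) hpb_htpy w = w"
      using htpy(3) by (cases w) (auto simp: hpb_whisker_def hpb_htpy_def F_pts path_setD(2))
    then show ?thesis
      by (simp add: htpy(4) sq(3)[OF Q0 htpy(1,2,3)])
  qed (simp_all add: sq[OF Q0])
  define \<tau> where "\<tau> = ?sq Q' \<circ> (hpo_inr A B \<circ> \<sigma>)"
  have pe: "pmap P X S.cylinder_proj" unfolding P_def by (rule S.pmap_cylinder_proj)
  have p\<sigma>: "pmap X P (hpo_inr A B \<circ> \<sigma>)" by (rule pmap_comp[OF \<sigma>'(1) J.r])
  have pQ': "pmap P P (?sq Q')"
    using J.pmap_square_map[OF F B fst snd pmap_id Q'] unfolding P_def .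
  have "phomotopic P P (hpo_inr A B \<circ> \<sigma> \<circ> S.cylinder_proj) (?sq T)"
    using S.inr_section_phomotopic[OF J.fibre_join_axioms] unfolding P_def T_def case_prod_unfold .
  then have "phomotopic P P (?sq Q' \<circ> (hpo_inr A B \<circ> \<sigma> \<circ> S.cylinder_proj)) (?sq Q' \<circ> ?sq T)"
    by (rule phomotopic_postcomp[OF P _ pQ'])
  then have "phomotopic P P (\<tau> \<circ> S.cylinder_proj) (?sq T2)"
    by (rule phomotopic_cong[OF P]) (auto simp: \<tau>_def comp)
  \<comment> \<open>the back and forth of \<open>T2\<close> is contracted by a linear homotopy of the time parameters\<close>
  also have "phomotopic P P (?sq T2) (?sq hpb_htpy)"
  proof (rule J.square_map_phomotopic[OF F B fst snd, folded P_def, where k = "snd" and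
        Q = "\<lambda>(s, (u, w)). S.track ((1 - s) * min (6 * u) (5 - 4 * u) + s * u, w)"])
    show "phomotopy B B id id Product_Type.snd"
      by (simp add: phomotopy_def continuous_map_snd)
  qed (auto simp: S.track_simps T2_def ends intro!: S.continuous_map_track_app continuous_intros S.real_parameters)
  also have "phomotopic P P (?sq hpb_htpy) id"
    by (rule phomotopic_cong[OF P phomotopic_refl[OF pmap_id]]) (auto simp: sq_id)
  finally have \<tau>: "phomotopic P P (\<tau> \<circ> S.cylinder_proj) id" .
  have "phomotopic X X (S.cylinder_proj \<circ> (hpo_inr A B \<circ> \<sigma>)) id"
    by (rule phomotopic_cong[OF X phomotopic_sym[OF \<sigma>'(2)]]) (auto simp: S.cylinder_proj_simps)
  then have "homotopy_section P X S.cylinder_proj (hpo_inr A B \<circ> \<sigma>)"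
    using p\<sigma> by (simp add: homotopy_section_def)
  moreover have "pmap X P \<tau>" unfolding \<tau>_def by (rule pmap_comp[OF p\<sigma> pQ'])
  ultimately show ?thesis
    using homotopy_section_left_inverse[OF P X pe _ _ \<tau>] unfolding S.cylinder_proj_def by blast
qed

section \<open>The Ganea construction\<close>

context
  fixes tag :: "'a \<Rightarrow> 'b" and untag and P :: "'a pspace"
  assumes untag: "\<And>z. untag (tag z) = z"
begin

lemma pts_tagged: "pts (tagged tag untag P) = tag ` pts P"
  unfolding tagged_def by (auto simp: topspace_pullback_topology untag)

lemma pmap_tag: "pmap P (tagged tag untag P) tag"
  unfolding pmap_def tagged_def pspace.sel
  by (intro conjI continuous_map_pullback')
     (use untag in \<open>auto simp: o_def\<close>)

lemma pmap_untag: "pmap (tagged tag untag P) P untag"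
  unfolding pmap_def tagged_def pspace.sel
  using continuous_map_pullback[of "ptop P" "ptop P" id "range tag" untag] untag by simp

lemma pointed_tagged: "pointed_space P \<Longrightarrow> pointed_space (tagged tag untag P)"
  unfolding pointed_space_def pts_tagged by (simp add: tagged_def)

end

lemma fibre_join_tagged:
  assumes J: "fibre_join A G X \<iota> g J l r c e" and untag: "\<And>z. untag (tag z) = z"
  shows "fibre_join A G X \<iota> g (tagged tag untag J) (tag \<circ> l) (tag \<circ> r) (tag \<circ> c) (e \<circ> untag)"
proof -
  interpret fibre_join A G X \<iota> g J l r c e by (rule J)
  note t = pmap_tag[of untag tag J, OF untag] and u = pmap_untag[of untag tag J, OF untag]
  have "phomotopy (hpb A G X \<iota> g) (tagged tag untag J) (tag \<circ> l \<circ> hpb_fst) (tag \<circ> r \<circ> hpb_snd) (tag \<circ> c)"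
    using phomotopyD[OF c] pmapD[OF t] by (auto simp: phomotopy_def intro: continuous_map_compose)
  then show ?thesis
    by unfold_locales
       (use A G X J iota g pmap_comp[OF l t] pmap_comp[OF r t] pmap_comp[OF u e]
         pointed_tagged[of untag tag J, OF untag] in \<open>auto simp: untag e_l e_r e_c\<close>)
qed

lemma gan_0: "gan_G A X \<iota> 0 = tagged GBase un_GBase A" "gan_g A X \<iota> 0 = \<iota> \<circ> un_GBase"
  by (simp_all add: gan_G_def gan_g_def)

lemma gan_Suc:
  "gan_G A X \<iota> (Suc n) =
     tagged GStep un_GStep (hpo (gan_F A X \<iota> n) A (gan_G A X \<iota> n) hpb_fst hpb_snd)"
  "gan_g A X \<iota> (Suc n) = hpo_whisker \<iota> (gan_g A X \<iota> n) hpb_htpy \<circ> un_GStep"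
  by (simp_all add: gan_G_def gan_g_def gan_F_def Let_def)

locale ganea_construction =
  fixes A :: "'a pspace" and X :: "'x pspace" and \<iota>
  assumes A: "pointed_space A" and X: "pointed_space X" and iota: "pmap A X \<iota>"
begin

abbreviation "G \<equiv> gan_G A X \<iota>"
abbreviation "g \<equiv> gan_g A X \<iota>"
abbreviation "\<gamma> \<equiv> gan_gamma A X \<iota>"

lemma fibre_join_step:
  assumes "pointed_space (G n)" "pmap (G n) X (g n)"
  shows "fibre_join A (G n) X \<iota> (g n) (G (Suc n))
    (gan_alpha (Suc n)) (\<gamma> n) (gan_htpy A X \<iota> n) (g (Suc n))"
  using fibre_join_tagged[OF fibre_join_standard[OF A assms(1) X iota assms(2)], of un_GStep GStep]
  by (simp add: gan_Suc gan_F_def gan_alpha_def gan_gamma_def gan_htpy_def)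

lemma pointed_G_pmap_g: "pointed_space (G n) \<and> pmap (G n) X (g n)"
proof (induction n)
  case 0
  show ?case
    unfolding gan_0 by (intro conjI pointed_tagged pmap_comp[OF pmap_untag iota] A) simp_all
next
  case (Suc n)
  then interpret fibre_join A "G n" X \<iota> "g n" "G (Suc n)" "gan_alpha (Suc n)" "\<gamma> n"
    "gan_htpy A X \<iota> n" "g (Suc n)" by (intro fibre_join_step) auto
  show ?case using J e by simp
qed

lemmas pointed_G = conjunct1[OF pointed_G_pmap_g] and pmap_g = conjunct2[OF pointed_G_pmap_g]

lemmas fibre_join_G = fibre_join_step[OF pointed_G pmap_g]

lemma pmap_alpha: "pmap A (G n) (gan_alpha n)"
proof (cases n)
  case 0
  then show ?thesis using pmap_tag[of un_GBase GBase A] by (simp add: gan_0 gan_alpha_def)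
next
  case (Suc m)
  interpret fibre_join A "G m" X \<iota> "g m" "G (Suc m)" "gan_alpha (Suc m)" "\<gamma> m"
    "gan_htpy A X \<iota> m" "g (Suc m)" by (rule fibre_join_G)
  show ?thesis using l Suc by simp
qed

lemma g_alpha: "a \<in> pts A \<Longrightarrow> g n (gan_alpha n a) = \<iota> a"
  by (cases n) (simp_all add: gan_0 gan_Suc gan_alpha_def)

lemma pmap_gamma: "pmap (G n) (G (Suc n)) (\<gamma> n)"
  using fibre_join.r[OF fibre_join_G] .

text \<open>
  For \<open>B = A\<close> and \<open>j = id\<close> this represents \<open>\<omega>\<^sub>n\<^sub>+\<^sub>1\<close> on the standard pushout; for the pushout defining \<open>G\<^sub>1\<close> it
  is homotopic to the composite \<open>G\<^sub>1 \<rightarrow> G\<^sub>n\<^sub>+\<^sub>1\<close> of the maps \<open>\<gamma>\<close>.  The space \<open>B\<close> and the map \<open>j\<close> allow for both,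
  because \<open>G\<^sub>0\<close> is only a copy of \<open>A\<close>.
\<close>

definition pushout_to_ganea ::
  "('w \<Rightarrow> 'a) \<Rightarrow> ('w \<Rightarrow> 'b) \<Rightarrow> ('b \<Rightarrow> 'a) \<Rightarrow> (real \<times> 'w \<Rightarrow> 'x) \<Rightarrow> nat \<Rightarrow> ('w, 'a, 'b) dcyl \<Rightarrow> ('a, 'x) gan" where
  "pushout_to_ganea \<eta> \<beta> j Q n =
     square_map (gan_alpha (Suc n)) (\<gamma> n) (gan_htpy A X \<iota> n) \<eta> \<beta> (gan_alpha n \<circ> j) Q"

context
  fixes W :: "'w pspace" and B :: "'b pspace" and \<eta> \<beta> j Q
  assumes W: "pointed_space W" and B: "pointed_space B"
    and eta: "pmap W A \<eta>" and beta: "pmap W B \<beta>" and j: "pmap B A j"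
    and Q: "phomotopy W X (\<iota> \<circ> \<eta>) (\<iota> \<circ> j \<circ> \<beta>) Q"
begin

lemma alpha_j: "pmap B (G n) (gan_alpha n \<circ> j)"
  by (rule pmap_comp[OF j pmap_alpha])

lemma Q_alpha: "phomotopy W X (\<iota> \<circ> \<eta>) (g n \<circ> (gan_alpha n \<circ> j) \<circ> \<beta>) Q"
  using Q pmapD(3)[OF beta] pmapD(3)[OF j] by (simp add: phomotopy_def g_alpha)

lemma pmap_pushout_to_ganea: "pmap (hpo W A B \<eta> \<beta>) (G (Suc n)) (pushout_to_ganea \<eta> \<beta> j Q n)"
  unfolding pushout_to_ganea_def
  by (rule fibre_join.pmap_square_map[OF fibre_join_G W B eta beta alpha_j Q_alpha])

lemma gamma_pushout_to_ganea: "phomotopic (hpo W A B \<eta> \<beta>) (G (Suc (Suc n))) (\<gamma> (Suc n) \<circ> pushout_to_ganea \<eta> \<beta> j Q n) (pushout_to_ganea \<eta> \<beta> j Q (Suc n))"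
  unfolding pushout_to_ganea_def
  by (rule fibre_join.inr_square_map_phomotopic[OF fibre_join_G fibre_join_G W B eta beta j alpha_j _ Q])
     (use pmapD(3)[OF j] in \<open>simp add: g_alpha\<close>)

lemma gammas_pushout_to_ganea: "phomotopic (hpo W A B \<eta> \<beta>) (G (Suc d)) (gan_gammas A X \<iota> 1 d \<circ> pushout_to_ganea \<eta> \<beta> j Q 0) (pushout_to_ganea \<eta> \<beta> j Q d)"
proof (induction d)
  case 0
  show ?case using phomotopic_refl[OF pmap_pushout_to_ganea[of 0]] by simp
next
  case (Suc d)
  note P = pointed_hpo[OF A eta beta]
  have "phomotopic (hpo W A B \<eta> \<beta>) (G (Suc (Suc d)))
      (\<gamma> (Suc d) \<circ> (gan_gammas A X \<iota> 1 d \<circ> pushout_to_ganea \<eta> \<beta> j Q 0)) (\<gamma> (Suc d) \<circ> pushout_to_ganea \<eta> \<beta> j Q d)"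
    by (rule phomotopic_postcomp[OF P Suc pmap_gamma])
  from phomotopic_trans[OF this gamma_pushout_to_ganea]
  show ?case unfolding gan_gammas.simps plus_1_eq_Suc comp_assoc .
qed

lemma g_1_pushout_to_ganea:
  assumes "z \<in> pts (hpo W A B \<eta> \<beta>)"
  shows "g 1 (pushout_to_ganea \<eta> \<beta> j Q 0 z) = hpo_whisker \<iota> (\<iota> \<circ> j) Q z"
proof -
  note e = fibre_join.e_square_map[OF fibre_join_G[of 0] W B eta beta alpha_j Q_alpha, folded pushout_to_ganea_def]
  note wh = hpo_whisker_phomotopy_inr[OF eta beta iota pmap_comp[OF j iota] Q]
    hpo_whisker_phomotopy_htpy[OF eta beta iota pmap_comp[OF j iota] Q]
  show ?thesis using assms
  proof (cases rule: hpo_point_cases[OF eta beta, consumes 1, case_names inl inr htpy])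
    case (inr b)
    then show ?thesis using e(2)[of b] pmapD(3)[OF j] g_alpha by (simp add: wh)
  qed (use e(1,3) in \<open>simp_all add: wh\<close>)
qed

end

text \<open>
  Both sides are compared on the pushout \<open>P\<close>, which is \<open>G\<^sub>1\<close> before relabelling.  For \<open>n > 0\<close> the map
  \<open>\<sigma> \<circ> \<iota>\<close> is first moved from \<open>\<alpha>\<^sub>n\<close> along the join lines over constant paths to \<open>\<gamma>\<^sub>n\<^sub>-\<^sub>1 \<circ> \<alpha>\<^sub>n\<^sub>-\<^sub>1\<close>, so that it
  can return to \<open>\<alpha>\<^sub>n\<close> over the loop that is to be absorbed.  For \<open>n = 0\<close> the hypotheses make \<open>\<iota>\<close> a homotopy
  equivalence with inverse \<open>\<sigma>\<close>, and so is \<open>g\<^sub>1\<close>.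
\<close>

lemma gammas_section:
  assumes \<sigma>: "homotopy_section (G n) X (g n) \<sigma>" and L: "phomotopic A (G n) (\<sigma> \<circ> \<iota>) (gan_alpha n)"
  shows "phomotopic (G 1) (G (Suc n)) ((\<gamma> n \<circ> \<sigma>) \<circ> g 1) (gan_gammas A X \<iota> 1 n)"
proof -
  define j :: "('a, 'x) gan \<Rightarrow> 'a" where "j = un_GBase"
  have j: "pmap (G 0) A j" using pmap_untag[of un_GBase GBase A] by (simp add: j_def gan_0)
  have g0: "g 0 = \<iota> \<circ> j" by (simp add: gan_0 j_def)
  have id: "gan_alpha 0 (j b) = b" if "b \<in> pts (G 0)" for b
    using that by (auto simp: gan_0 pts_tagged j_def gan_alpha_def)
  define F where "F = gan_F A X \<iota> 0"
  have F_eq: "F = hpb A (G 0) X \<iota> (\<iota> \<circ> j)" by (simp add: F_def gan_F_def g0)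
  have F: "pointed_space F" unfolding F_eq
    by (rule pointed_hpb[OF A pointed_G X iota pmap_comp[OF j iota]])
  have eta: "pmap F A hpb_fst" and beta: "pmap F (G 0) hpb_snd" unfolding F_eq
    by (rule pmap_hpb_fst pmap_hpb_snd)+
  have Q: "phomotopy F X (\<iota> \<circ> hpb_fst) (\<iota> \<circ> j \<circ> hpb_snd) hpb_htpy" unfolding F_eq
    by (rule phomotopy_hpb_htpy[OF iota pmap_comp[OF j iota]])
  define P where "P = hpo F A (G 0) hpb_fst hpb_snd"
  have P: "pointed_space P" unfolding P_def by (rule pointed_hpo[OF A eta beta])
  have G1: "G 1 = tagged GStep un_GStep P" by (simp add: gan_Suc P_def F_def)
  have g1: "g 1 = hpo_whisker \<iota> (\<iota> \<circ> j) hpb_htpy \<circ> un_GStep" by (simp add: gan_Suc g0)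
  have un: "pmap (G 1) P un_GStep" unfolding G1 by (rule pmap_untag) simp
  have st: "pmap P (G 1) GStep" unfolding G1 by (rule pmap_tag) simp
  have PG1: "GStep (un_GStep z) = z" if "z \<in> pts (G 1)" for z
    using that unfolding G1 by (auto simp: pts_tagged)
  have pull: "phomotopic (G 1) Z (u \<circ> un_GStep) (v \<circ> un_GStep)" if "phomotopic P Z u v" for Z u v
    by (rule phomotopic_precomp[OF pointed_G P that un])
  show ?thesis
  proof (cases n)
    case 0
    have "phomotopic (G 0) (G 0) (\<sigma> \<circ> \<iota> \<circ> j) (gan_alpha 0 \<circ> j)"
      using phomotopic_precomp[OF pointed_G A L j] unfolding 0 .
    then have "phomotopic (G 0) (G 0) (\<sigma> \<circ> \<iota> \<circ> j) id"
      by (rule phomotopic_cong[OF pointed_G]) (simp_all add: id)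
    then have "phomotopic P P (hpo_inr A (G 0) \<circ> \<sigma> \<circ> hpo_whisker \<iota> (\<iota> \<circ> j) hpb_htpy) id"
      using inr_section_phomotopic_id[OF A pointed_G X iota j] \<sigma> unfolding P_def F_eq 0 g0 by blast
    from pull[OF phomotopic_postcomp[OF P this st]]
    have "phomotopic (G 1) (G 1) (\<gamma> 0 \<circ> \<sigma> \<circ> g 1) id"
      by (rule phomotopic_cong[OF pointed_G]) (use PG1 in \<open>simp_all add: g1[unfolded One_nat_def] gan_gamma_def\<close>)
    then show ?thesis by (simp only: 0 gan_gammas.simps One_nat_def)
  next
    case (Suc m)
    have k: "pmap (G 0) (G m) (gan_alpha m \<circ> j)" by (rule pmap_comp[OF j pmap_alpha])
    interpret J: fibre_join A "G m" X \<iota> "g m" "G (Suc m)" "gan_alpha (Suc m)" "\<gamma> m"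
      "gan_htpy A X \<iota> m" "g (Suc m)" by (rule fibre_join_G)
    have "phomotopic A (G (Suc m)) (gan_alpha (Suc m)) (\<gamma> m \<circ> gan_alpha m)"
    proof (rule phomotopicI[OF A])
      have "continuous_map (prod_topology I01 (ptop A)) (ptop X) (\<lambda>(u, a). \<iota> a)"
        using continuous_map_app[OF pmapD(1)[OF iota] continuous_map_snd] by (simp add: case_prod_unfold)
      then have "phomotopy A X (\<iota> \<circ> id) (g m \<circ> gan_alpha m \<circ> id) (\<lambda>(u, a). \<iota> a)"
        using pmapD(2)[OF iota] by (simp add: phomotopy_def g_alpha)
      from J.phomotopy_square_map[OF A A pmap_id pmap_id pmap_alpha this]
      show "phomotopy A (G (Suc m)) (gan_alpha (Suc m)) (\<gamma> m \<circ> gan_alpha m)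
        (\<lambda>(t, w). gan_htpy A X \<iota> m (t, hpb_whisker id (gan_alpha m \<circ> id) (\<lambda>(u, a). \<iota> a) w))"
        by simp
    qed
    with L have "phomotopic A (G (Suc m)) (\<sigma> \<circ> \<iota>) (\<gamma> m \<circ> gan_alpha m)"
      unfolding Suc by (rule phomotopic_trans)
    then have "phomotopic (G 0) (G (Suc m)) (\<sigma> \<circ> \<iota> \<circ> j) (\<gamma> m \<circ> (gan_alpha m \<circ> j))"
      using phomotopic_precomp[OF pointed_G A _ j] by (metis comp_assoc)
    then have "phomotopic P (G (Suc n)) (\<gamma> n \<circ> \<sigma> \<circ> hpo_whisker \<iota> (\<iota> \<circ> j) hpb_htpy)
        (pushout_to_ganea hpb_fst hpb_snd j hpb_htpy n)"
      unfolding P_def Suc pushout_to_ganea_def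
      by (intro inr_section_phomotopic_square_map[OF fibre_join_G fibre_join_G F pointed_G eta beta j k _ Q])
         (use pmapD(3)[OF j] \<sigma> Suc in \<open>auto simp: g_alpha\<close>)
    moreover have "phomotopic P (G (Suc n)) (gan_gammas A X \<iota> 1 n \<circ> pushout_to_ganea hpb_fst hpb_snd j hpb_htpy 0)
        (pushout_to_ganea hpb_fst hpb_snd j hpb_htpy n)"
      unfolding P_def by (rule gammas_pushout_to_ganea[OF F pointed_G eta beta j Q])
    ultimately have "phomotopic P (G (Suc n)) (\<gamma> n \<circ> \<sigma> \<circ> hpo_whisker \<iota> (\<iota> \<circ> j) hpb_htpy)
        (gan_gammas A X \<iota> 1 n \<circ> pushout_to_ganea hpb_fst hpb_snd j hpb_htpy 0)"
      by (blast intro: phomotopic_trans phomotopic_sym)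
    moreover have "pushout_to_ganea hpb_fst hpb_snd j hpb_htpy 0 z = GStep z" if "z \<in> pts P" for z
    proof -
      have k0: "pmap (G 0) (G 0) (gan_alpha 0 \<circ> j)" by (rule pmap_comp[OF j pmap_alpha])
      have Q0: "phomotopy F X (\<iota> \<circ> hpb_fst) (g 0 \<circ> (gan_alpha 0 \<circ> j) \<circ> hpb_snd) hpb_htpy"
        using Q_alpha[OF F pointed_G eta beta j Q] .
      note sq = fibre_join.square_map_inl[OF fibre_join_G F pointed_G eta beta k0 Q0]
        fibre_join.square_map_inr[OF fibre_join_G F pointed_G eta beta k0 Q0]
        fibre_join.square_map_htpy[OF fibre_join_G F pointed_G eta beta k0 Q0]
      show ?thesis using that unfolding P_def
      proof (cases rule: hpo_point_cases[OF eta beta, consumes 1, case_names inl inr htpy])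
        case (inl a)
        then show ?thesis unfolding pushout_to_ganea_def by (simp add: sq(1)) (simp add: gan_alpha_def)
      next
        case (inr b)
        then show ?thesis unfolding pushout_to_ganea_def by (simp add: sq(2) id) (simp add: gan_gamma_def)
      next
        case (htpy t w)
        have "hpb_whisker hpb_fst ((gan_alpha 0 \<circ> j) \<circ> hpb_snd) hpb_htpy w = w"
          using htpy(3) id unfolding F_eq
          by (cases w) (auto simp: topspace_hpb hpb_whisker_def hpb_htpy_def path_setD(2))
        then show ?thesis unfolding pushout_to_ganea_def
          by (simp only: htpy(4) sq(3)[OF htpy(1,2,3)]) (simp add: gan_htpy_def F_def)
      qed
    qed
    ultimately have "phomotopic P (G (Suc n)) (\<gamma> n \<circ> \<sigma> \<circ> hpo_whisker \<iota> (\<iota> \<circ> j) hpb_htpy)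
        (gan_gammas A X \<iota> 1 n \<circ> GStep)"
      by (auto intro: phomotopic_cong[OF P])
    from pull[OF this] show ?thesis
      by (rule phomotopic_cong[OF pointed_G]) (use PG1 in \<open>simp_all add: g1[unfolded One_nat_def]\<close>)
  qed
qed

end

text \<open>
  A path in \<open>X\<close> from \<open>f (\<theta> a)\<close> is at the same time a path for \<open>a\<close> and for \<open>\<theta> a\<close>, so \<open>\<theta>\<close> induces maps of
  the joins that leave the paths unchanged and hence commute strictly with the projections.
\<close>

lemma ganea_functorial:
  assumes A: "pointed_space A" and S: "pointed_space S" and X: "pointed_space X"
    and \<theta>: "pmap A S \<theta>" and f: "pmap S X f"
  shows "\<exists>T. pmap (gan_G A X (f \<circ> \<theta>) n) (gan_G S X f n) T \<and>
    (\<forall>z\<in>pts (gan_G A X (f \<circ> \<theta>) n). gan_g S X f n (T z) = gan_g A X (f \<circ> \<theta>) n z)"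
proof -
  interpret A: ganea_construction A X "f \<circ> \<theta>" by unfold_locales (fact A X pmap_comp[OF \<theta> f])+
  interpret S: ganea_construction S X f by unfold_locales (fact S X f)+
  show ?thesis
  proof (induction n)
    case 0
    have un: "pmap (A.G 0) A un_GBase" unfolding gan_0 by (rule pmap_untag) simp
    have "pmap (A.G 0) (S.G 0) (gan_alpha 0 \<circ> (\<theta> \<circ> un_GBase))"
      by (rule pmap_comp[OF pmap_comp[OF un \<theta>] S.pmap_alpha])
    moreover have "S.g 0 ((gan_alpha 0 \<circ> (\<theta> \<circ> un_GBase)) z) = A.g 0 z" if "z \<in> pts (A.G 0)" for z
      by (simp add: gan_0 gan_alpha_def)
    ultimately show ?case by blast
  next
    case (Suc n)
    then obtain T where T: "pmap (A.G n) (S.G n) T"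
      and gT: "\<And>z. z \<in> pts (A.G n) \<Longrightarrow> S.g n (T z) = A.g n z" by blast
    interpret J: fibre_join S "S.G n" X f "S.g n" "S.G (Suc n)" "gan_alpha (Suc n)" "S.\<gamma> n"
      "gan_htpy S X f n" "S.g (Suc n)" by (rule S.fibre_join_G)
    define F where "F = gan_F A X (f \<circ> \<theta>) n"
    note Fdef = F_def gan_F_def
    have F: "pointed_space F" unfolding Fdef
      by (rule pointed_hpb[OF A A.pointed_G X A.iota A.pmap_g])
    have eta: "pmap F A hpb_fst" and beta: "pmap F (A.G n) hpb_snd" unfolding Fdef
      by (rule pmap_hpb_fst pmap_hpb_snd)+
    have H: "phomotopy F X (f \<circ> \<theta> \<circ> hpb_fst) (A.g n \<circ> hpb_snd) hpb_htpy" unfolding Fdef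
      by (rule phomotopy_hpb_htpy[OF A.iota A.pmap_g])
    then have Q: "phomotopy F X (f \<circ> (\<theta> \<circ> hpb_fst)) (S.g n \<circ> T \<circ> hpb_snd) hpb_htpy"
      using pmapD(3)[OF beta] by (simp add: phomotopy_def gT)
    let ?h = "\<lambda>(t, w). gan_htpy S X f n (t, hpb_whisker (\<theta> \<circ> hpb_fst) (T \<circ> hpb_snd) hpb_htpy w)"
    have h: "phomotopy F (S.G (Suc n)) (gan_alpha (Suc n) \<circ> \<theta> \<circ> hpb_fst) (S.\<gamma> n \<circ> T \<circ> hpb_snd) ?h"
      using J.phomotopy_square_map[OF F A.pointed_G pmap_comp[OF eta \<theta>] beta T Q] by (simp add: comp_assoc)
    let ?T = "hpo_whisker (gan_alpha (Suc n) \<circ> \<theta>) (S.\<gamma> n \<circ> T) ?h"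
    note al = pmap_comp[OF \<theta> J.l] and ga = pmap_comp[OF T J.r]
    note wh = hpo_whisker_phomotopy_inr[OF eta beta al ga h] hpo_whisker_phomotopy_htpy[OF eta beta al ga h]
    note wh' = hpo_whisker_phomotopy_inr[OF eta beta A.iota A.pmap_g H]
      hpo_whisker_phomotopy_htpy[OF eta beta A.iota A.pmap_g H]
    have GS: "A.G (Suc n) = tagged GStep un_GStep (hpo F A (A.G n) hpb_fst hpb_snd)"
      by (simp add: gan_Suc F_def)
    have un: "pmap (A.G (Suc n)) (hpo F A (A.G n) hpb_fst hpb_snd) un_GStep"
      unfolding GS by (rule pmap_untag) simp
    have "S.g (Suc n) (?T z) = hpo_whisker (f \<circ> \<theta>) (A.g n) hpb_htpy z"
      if "z \<in> pts (hpo F A (A.G n) hpb_fst hpb_snd)" for z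
      using that
    proof (cases rule: hpo_point_cases[OF eta beta, consumes 1, case_names inl inr htpy])
      case (inl a)
      then show ?thesis using S.g_alpha pmapD(3)[OF \<theta>] by simp
    next
      case (inr b)
      then show ?thesis using J.e_r pmapD(3)[OF T] by (simp add: wh wh' gT)
    next
      case (htpy t w)
      have "S.g (Suc n) (gan_htpy S X f n (t, hpb_whisker (\<theta> \<circ> hpb_fst) (T \<circ> hpb_snd) hpb_htpy w)) =
          hpb_htpy (t, w)"
        by (rule J.whisker_line_ends(3)[OF _ _ htpy(3) phomotopyD(1)[OF Q]])
           (use htpy phomotopyD[OF Q] pmapD(3)[OF eta] pmapD(3)[OF beta] pmapD(3)[OF \<theta>] pmapD(3)[OF T] in auto)
      then show ?thesis using htpy by (simp add: wh wh')
    qed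
    then have "S.g (Suc n) ((?T \<circ> un_GStep) z) = A.g (Suc n) z" if "z \<in> pts (A.G (Suc n))" for z
      using that pmapD(3)[OF un] by (simp add: gan_Suc(2)[of A])
    moreover have "pmap (A.G (Suc n)) (S.G (Suc n)) (?T \<circ> un_GStep)"
      by (rule pmap_comp[OF un pmap_hpo_whisker[OF eta beta al ga h]])
    ultimately show ?case by blast
  qed
qed

section \<open>The four inequalities\<close>

lemma least_enat_le_plus:
  assumes "\<And>n. P n \<Longrightarrow> Q (n + d)"
  shows "least_enat Q \<le> least_enat P + enat d"
proof (cases "\<exists>n. P n")
  case True
  then obtain m where "P m" by blast
  then have "least_enat P \<in> enat ` {n. P n}"
    using LeastI[of "\<lambda>x. x \<in> enat ` {n. P n}" "enat m"] by (auto simp: least_enat_def Inf_enat_def)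
  then obtain n where n: "P n" "least_enat P = enat n" by auto
  then have "least_enat Q \<le> enat (n + d)"
    unfolding least_enat_def by (intro Inf_lower) (auto dest: assms)
  then show ?thesis by (simp add: n)
next
  case False
  then show ?thesis by (simp add: least_enat_def Inf_enat_def)
qed

locale hopf_data = 
  fixes W :: "'w pspace" and A :: "'a pspace" and S :: "'s pspace" and X :: "'x pspace"
    and \<eta> \<beta> :: "'w \<Rightarrow> 'a" and \<theta> :: "'a \<Rightarrow> 's" and H :: "real \<times> 'w \<Rightarrow> 's" and f :: "'s \<Rightarrow> 'x"
  assumes W: "pointed_space W" and A: "pointed_space A" and S: "pointed_space S" and X: "pointed_space X"
    and sq: "hpushout_square W A A S \<eta> \<beta> \<theta> \<theta> H"
    and f: "pmap S X f"
begin

lemma eta: "pmap W A \<eta>" and beta: "pmap W A \<beta>" and \<theta>: "pmap A S \<theta>"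
  and H: "phomotopy W S (\<theta> \<circ> \<eta>) (\<theta> \<circ> \<beta>) H"
  and comparison: "phomotopy_equivalence (hpo W A A \<eta> \<beta>) S (hpo_whisker \<theta> \<theta> H)"
  using sq by (auto simp: hpushout_square_def)

sublocale ganea_construction A X "f \<circ> \<theta>"
  by unfold_locales (fact A X pmap_comp[OF \<theta> f])+

lemma Q: "phomotopy W X (f \<circ> \<theta> \<circ> \<eta>) (f \<circ> \<theta> \<circ> id \<circ> \<beta>) (f \<circ> H)"
  using phomotopyD[OF H] pmapD[OF f] by (auto simp: phomotopy_def intro: continuous_map_compose)

abbreviation "\<omega> \<equiv> hopf_omega W A S X \<eta> \<beta> \<theta> H f"

lemma omega_comparison:
  "pmap S (G (Suc n)) (\<omega> (Suc n))"
  "phomotopic (hpo W A A \<eta> \<beta>) (G (Suc n)) (\<omega> (Suc n) \<circ> hpo_whisker \<theta> \<theta> H) (pushout_to_ganea \<eta> \<beta> id (f \<circ> H) n)"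
proof -
  have eq: "pushout_to_ganea \<eta> \<beta> id (f \<circ> H) n = hpo_whisker (gan_alpha (Suc n)) (\<gamma> n \<circ> gan_alpha n)
      (\<lambda>(t, w). gan_htpy A X (f \<circ> \<theta>) n (t, hopf_whisker \<eta> \<beta> H f n w))"
    unfolding pushout_to_ganea_def square_map_def hopf_whisker_def by simp
  show "pmap S (G (Suc n)) (\<omega> (Suc n))"
    "phomotopic (hpo W A A \<eta> \<beta>) (G (Suc n)) (\<omega> (Suc n) \<circ> hpo_whisker \<theta> \<theta> H) (pushout_to_ganea \<eta> \<beta> id (f \<circ> H) n)"
    using hpushout_whisker_spec[OF A sq, of "G (Suc n)"] pmap_pushout_to_ganea[OF W A eta beta pmap_id Q, of n]
    unfolding hopf_omega_def Let_def eq by simp_all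
qed

lemma omega_theta: "phomotopic A (G (Suc n)) (\<omega> (Suc n) \<circ> \<theta>) (gan_alpha (Suc n))"
proof -
  have "phomotopic A (G (Suc n)) (\<omega> (Suc n) \<circ> hpo_whisker \<theta> \<theta> H \<circ> hpo_inl) (pushout_to_ganea \<eta> \<beta> id (f \<circ> H) n \<circ> hpo_inl)"
    by (rule phomotopic_precomp[OF A pointed_hpo[OF A eta beta] omega_comparison(2) pmap_hpo_inl[OF eta beta]])
  moreover have "\<omega> (Suc n) \<circ> hpo_whisker \<theta> \<theta> H \<circ> hpo_inl = \<omega> (Suc n) \<circ> \<theta>"
    "pushout_to_ganea \<eta> \<beta> id (f \<circ> H) n \<circ> hpo_inl = gan_alpha (Suc n)"
    by (auto simp: fun_eq_iff pushout_to_ganea_def square_map_def)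
  ultimately show ?thesis by simp
qed

text \<open>
  On the standard pushout, \<open>\<sigma> \<circ> f\<close> is \<open>\<sigma> \<circ> g\<^sub>1 \<circ> \<omega>\<^sub>1\<close>, which is homotopic to
  \<open>\<gamma>\<^sub>1\<^sub>,\<^sub>d\<^sub>+\<^sub>1 \<circ> \<omega>\<^sub>1\<close>, hence to \<open>\<omega>\<^sub>d\<^sub>+\<^sub>1\<close>.  The comparison map is an equivalence, so the
  homotopy descends to \<open>S\<close>.
\<close>

lemma section_f_omega:
  assumes \<sigma>: "pmap X (G (Suc d)) \<sigma>"
    and \<sigma>g: "phomotopic (G 1) (G (Suc d)) (\<sigma> \<circ> g 1) (gan_gammas A X (f \<circ> \<theta>) 1 d)"
  shows "phomotopic S (G (Suc d)) (\<sigma> \<circ> f) (\<omega> (Suc d))"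
proof -
  let ?P = "hpo W A A \<eta> \<beta>" and ?w = "hpo_whisker \<theta> \<theta> H"
  let ?\<Phi> = "pushout_to_ganea \<eta> \<beta> id (f \<circ> H)"
  note P = pointed_hpo[OF A eta beta]
  obtain q where w: "pmap ?P S ?w" and q: "pmap S ?P q" "phomotopic S S (?w \<circ> q) id"
    using comparison by (auto simp: phomotopy_equivalence_def)
  note wh = hpo_whisker_phomotopy_inr[OF eta beta \<theta> \<theta> H] hpo_whisker_phomotopy_htpy[OF eta beta \<theta> \<theta> H]
  note wh' = hpo_whisker_phomotopy_inr[OF eta beta iota pmap_comp[OF pmap_id iota] Q, unfolded comp_id]
    hpo_whisker_phomotopy_htpy[OF eta beta iota pmap_comp[OF pmap_id iota] Q, unfolded comp_id]
  have fw: "f (?w z) = g 1 (?\<Phi> 0 z)" if z: "z \<in> pts ?P" for z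
    unfolding g_1_pushout_to_ganea[OF W A eta beta pmap_id Q z] using z
    by (cases rule: hpo_point_cases[OF eta beta, consumes 1, case_names inl inr htpy]) (auto simp: wh wh')
  have \<Phi>0: "pmap ?P (G 1) (?\<Phi> 0)" using pmap_pushout_to_ganea[OF W A eta beta pmap_id Q, of 0] by simp
  have "phomotopic ?P (G (Suc d)) (\<sigma> \<circ> g 1 \<circ> ?\<Phi> 0) (gan_gammas A X (f \<circ> \<theta>) 1 d \<circ> ?\<Phi> 0)"
    by (rule phomotopic_precomp[OF P pointed_G \<sigma>g \<Phi>0])
  also have "phomotopic ?P (G (Suc d)) \<dots> (?\<Phi> d)"
    by (rule gammas_pushout_to_ganea[OF W A eta beta pmap_id Q])
  also have "phomotopic ?P (G (Suc d)) (?\<Phi> d) (\<omega> (Suc d) \<circ> ?w)"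
    by (rule phomotopic_sym[OF omega_comparison(2)])
  finally have "phomotopic ?P (G (Suc d)) (\<sigma> \<circ> f \<circ> ?w) (\<omega> (Suc d) \<circ> ?w)"
    by (rule phomotopic_cong[OF P]) (simp_all add: fw)
  from phomotopic_precomp[OF S P this q(1)]
  have 1: "phomotopic S (G (Suc d)) (\<sigma> \<circ> f \<circ> (?w \<circ> q)) (\<omega> (Suc d) \<circ> (?w \<circ> q))"
    by (simp add: comp_assoc)
  have "phomotopic S (G (Suc d)) (m \<circ> (?w \<circ> q)) m" if "pmap S (G (Suc d)) m" for m
    using phomotopic_postcomp[OF S q(2) that] by simp
  from this[OF pmap_comp[OF f \<sigma>]] this[OF omega_comparison(1)] 1 show ?thesis
    by (blast intro: phomotopic_trans phomotopic_sym)
qed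

lemma secat_le_relcat: "secat S X f \<le> relcat A X (f \<circ> \<theta>)"
proof -
  have "\<exists>\<sigma>. homotopy_section (gan_G S X f n) X (gan_g S X f n) \<sigma>"
    if "homotopy_section (G n) X (g n) \<sigma>" for n \<sigma>
  proof -
    obtain T where T: "pmap (G n) (gan_G S X f n) T"
      and gT: "\<And>z. z \<in> pts (G n) \<Longrightarrow> gan_g S X f n (T z) = g n z"
      using ganea_functorial[OF A S X \<theta> f, of n] by blast
    have \<sigma>: "pmap X (G n) \<sigma>" "phomotopic X X (g n \<circ> \<sigma>) id"
      using that by (auto simp: homotopy_section_def)
    have "phomotopic X X (gan_g S X f n \<circ> (T \<circ> \<sigma>)) id"
      by (rule phomotopic_cong[OF X \<sigma>(2)]) (use pmapD(3)[OF \<sigma>(1)] gT in auto)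
    with pmap_comp[OF \<sigma>(1) T] show ?thesis by (auto simp: homotopy_section_def)
  qed
  then have "least_enat (\<lambda>n. \<exists>\<sigma>. homotopy_section (gan_G S X f n) X (gan_g S X f n) \<sigma>) \<le>
      relcat A X (f \<circ> \<theta>) + enat 0"
    unfolding relcat_def by (intro least_enat_le_plus) auto
  then show ?thesis by (simp add: secat_def zero_enat_def[symmetric])
qed

lemma relcat_le_hcat: "relcat A X (f \<circ> \<theta>) \<le> hcat W A S X \<eta> \<beta> \<theta> H f"
proof -
  have "phomotopic A (G n) (\<sigma> \<circ> (f \<circ> \<theta>)) (gan_alpha n)"
    if "1 \<le> n" "phomotopic S (G n) (\<sigma> \<circ> f) (\<omega> n)" for n \<sigma>
  proof -
    define m where "m = n - 1"
    have n: "n = Suc m" using that(1) by (simp add: m_def)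
    have "phomotopic A (G n) (\<sigma> \<circ> f \<circ> \<theta>) (\<omega> n \<circ> \<theta>)"
      by (rule phomotopic_precomp[OF A S that(2) \<theta>])
    with omega_theta[of m] show ?thesis unfolding n by (metis comp_assoc phomotopic_trans)
  qed
  then have "relcat A X (f \<circ> \<theta>) \<le> hcat W A S X \<eta> \<beta> \<theta> H f + enat 0"
    unfolding relcat_def hcat_def Let_def by (intro least_enat_le_plus) auto
  then show ?thesis by (simp add: zero_enat_def[symmetric])
qed

lemma hcat_le_relcat_1: "hcat W A S X \<eta> \<beta> \<theta> H f \<le> relcat_k 1 A X (f \<circ> \<theta>)"
proof -
  have "phomotopic S (G n) (\<sigma> \<circ> f) (\<omega> n)"
    if "1 \<le> n" "homotopy_section (G n) X (g n) \<sigma>"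
      "phomotopic (G 1) (G n) (\<sigma> \<circ> g 1) (gan_gammas A X (f \<circ> \<theta>) 1 (n - 1))" for n \<sigma>
    using section_f_omega[of "n - 1" \<sigma>] that by (auto simp: homotopy_section_def)
  then have "hcat W A S X \<eta> \<beta> \<theta> H f \<le> relcat_k 1 A X (f \<circ> \<theta>) + enat 0"
    unfolding relcat_k_def hcat_def Let_def by (intro least_enat_le_plus) auto
  then show ?thesis by (simp add: zero_enat_def[symmetric])
qed

lemma relcat_1_le_relcat_plus_1: "relcat_k 1 A X (f \<circ> \<theta>) \<le> relcat A X (f \<circ> \<theta>) + 1"
proof -
  have "homotopy_section (G (Suc n)) X (g (Suc n)) (\<gamma> n \<circ> \<sigma>)"
    if "homotopy_section (G n) X (g n) \<sigma>" for n \<sigma>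
  proof -
    have \<sigma>: "pmap X (G n) \<sigma>" "phomotopic X X (g n \<circ> \<sigma>) id"
      using that by (auto simp: homotopy_section_def)
    have "phomotopic X X (g (Suc n) \<circ> (\<gamma> n \<circ> \<sigma>)) id"
      by (rule phomotopic_cong[OF X \<sigma>(2)])
         (use pmapD(3)[OF \<sigma>(1)] fibre_join.e_r[OF fibre_join_G] in auto)
    with pmap_comp[OF \<sigma>(1) pmap_gamma] show ?thesis by (simp add: homotopy_section_def)
  qed
  then have "relcat_k 1 A X (f \<circ> \<theta>) \<le> relcat A X (f \<circ> \<theta>) + enat 1"
    unfolding relcat_def relcat_k_def using gammas_section
    by (intro least_enat_le_plus) (auto, blast)
  then show ?thesis by (simp add: one_enat_def)
qed

end

theorem proposition6:
  fixes W :: "'w pspace" and A :: "'a pspace" and S :: "'s pspace" and X :: "'x pspace"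
    and \<eta> \<beta> :: "'w \<Rightarrow> 'a" and \<theta> :: "'a \<Rightarrow> 's" and H :: "real \<times> 'w \<Rightarrow> 's" and f :: "'s \<Rightarrow> 'x"
  assumes "pointed_space W" and "pointed_space A" and "pointed_space S" and "pointed_space X"
    and "hpushout_square W A A S \<eta> \<beta> \<theta> \<theta> H"
    and "pmap S X f"
  shows "secat S X f \<le> relcat A X (f \<circ> \<theta>) \<and>
    relcat A X (f \<circ> \<theta>) \<le> hcat W A S X \<eta> \<beta> \<theta> H f \<and>
    hcat W A S X \<eta> \<beta> \<theta> H f \<le> relcat_k 1 A X (f \<circ> \<theta>) \<and>
    relcat_k 1 A X (f \<circ> \<theta>) \<le> relcat A X (f \<circ> \<theta>) + 1"
proof -
  interpret hopf_data W A S X \<eta> \<beta> \<theta> H f by unfold_locales (fact assms)+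
  show ?thesis
    using secat_le_relcat relcat_le_hcat hcat_le_relcat_1 relcat_1_le_relcat_plus_1 by blast
qed

end
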